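(* Let $\eta\ge0$, $\mathfrak L>0$, $\varepsilon>0$ and $\delta\in(0,1)$ be such that $\delta<2\mathrm e^{-2}$ if $\eta>0$ and $\delta<4\exp\big(-\mathfrak c(1+q_+)(1-q_+)^{-(1-q_+)/2}\big)$ if $\eta=0$. Let $\nu$ be a probability distribution on $\mathbb R^d$ with $V_{q_+}\in L^1(\nu)$. Choose $\iota''\in(0,\iota')$ and define $C=C(q_+)\,c(\iota'')\,\|V_{q_+}\|_{L^1(\nu)}$, where $c(\iota'')$ is some constant such that $$\forall t\ge1:\quad(1+t)^{\frac{2q_+}{1+q_+}}\mathrm e^{-(\iota't)^{(1-q_+)/(1+q_+)}}\le c(\iota'')\,\mathrm e^{-(\iota''t)^{(1-q_+)/(1+q_+)}}.$$ Then, for $t\ge\Psi(\varepsilon,\delta/2)$ and burn-in length $v\ge1\vee\frac{(\log(2C/\delta))^{(1+q_+)/(1-q_+)}}{\iota''}$, for any $f\in\mathcal G(\eta,\mathfrak L)$, $$\mathbb P^\nu\big(|\mathbb H_{v,t}(f)-\mu(f)|\le\varepsilon\big)\ge1-\delta.$$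
   Context: Setting. $\|\cdot\|$ is the Euclidean norm. $X=(X_t)_{t\ge0}$ with the family $(\mathbb P^x)_{x\in\mathbb R^d}$ is the Markovian weak solution, with continuous paths, of $dX_t=b(X_t)\,dt+\sigma(X_t)\,dW_t$ on $\mathbb R^d$, with $X_0=x$ under $\mathbb P^x$; $\mathbb P^\nu=\int\mathbb P^x\,\nu(dx)$. Here $b:\mathbb R^d\to\mathbb R^d$ is locally Lipschitz with $\|b(x)\|\le \mathrm{const}\,(1+\|x\|^{q'})$ for some $q'\ge 0$; $\sigma:\mathbb R^d\to\mathbb R^{d\times d}$ is uniformly continuous, bounded and locally Lipschitz; $a:=\sigma\sigma^\top$ is uniformly elliptic, i.e. for some $\lambda>0$, $\langle a(x)\xi,\xi\rangle\ge\lambda\|\xi\|^2$ for all $x,\xi$. Drift condition: there are $q\in[-1,1)$, $M_0\ge0$, $\mathfrak r>0$ with $\langle b(x),x/\|x\|\rangle\le-\mathfrak r\|x\|^{-q}$ whenever $\|x\|\ge M_0$. $q_+=\max\{q,0\}$. Then $X$ has a unique invariant distribution $\mu$; $\mu(f)=\int f\,d\mu$. Function classes (Borel functions): $\mathcal G(\eta,\mathfrak L)=\{f:\mathbb R^d\to\mathbb R:\ |f(x)|\le\mathfrak L(1+\|x\|^\eta)\ \forall x\}$, $\mathcal F(\eta,\mathfrak L)=\{\tilde f-\mu(\tilde f):\tilde f\in\mathcal G(\eta,\mathfrak L)\}$. $\mathbb G_t(f)=t^{-1/2}\int_0^tf(X_s)\,ds$. Burn-in average: $\mathbb H_{v,t}(f)=\frac1t\int_v^{v+t}f(X_s)\,ds$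 for $t>0$, $v\ge0$. Constants. $\lambda_+$ is the smallest constant with $\langle a(x)x/\|x\|,x/\|x\|\rangle\le\lambda_+$ for all $x\ne0$; $\iota>0$ is fixed with $\mathfrak r>\iota\lambda_+(1-q_+)/2$; $V_{q_+}(x)=\exp(\iota\|x\|^{1-q_+})$; $\iota'=\iota^{(1+q_+)/(1-q_+)}(1+q_+)(\mathfrak r-\lambda_+\iota(1-q_+)/2)$. $C(q_+)$ is a constant (known to exist from the literature) such that, with $\|\nu\|_{TV}=\sup_{\|g\|_\infty\le1}|\nu(g)|$, $$\|\mathbb P^x(X_t\in\cdot)-\mu\|_{TV}\le C(q_+)V_{q_+}(x)(1+t)^{\frac{2q_+}{1+q_+}}\mathrm e^{-(\iota't)^{(1-q_+)/(1+q_+)}},\quad x\in\mathbb R^d,\ t\ge0.$$ For $\iota''\in(0,\iota')$, $$c(q,\iota'')=\tfrac12\Big(\tfrac{1+q_+}{1-q_+}\Big)^{1/(1-q_+)}\Big(\tfrac{(1-q_+)\iota''}{1+q_+}\Big)^{(1+q_+)/(2(1-q_+))},$$ and $\mathfrak c>0$ is a constant (known to exist from the literature) such that for all $f\in\mathcal F(0,\mathfrak L)$ and $u,t>0$ with $\mathfrak c(1+q_+)(1-q_+)^{-(1-q_+)/2}\le u<(c(q,\iota'')\lfloor t\rfloor/\sqrt t)^{1-q_+}$ one has $\mathbb P^\mu\big(|\mathbb G_t(f)|>2\mathfrak L(c(q,\iota'')^{-1}u^{1/(1-q_+)}+t^{-1/2})\big)\le2\mathrm e^{-u}$. $\mathfrak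 W$ is a constant, depending on $q,\eta,b,\sigma$ only, such that $\|\mathbb G_t(f)\|_{L^p(\mathbb P^\mu)}\le\mathfrak L\mathfrak W p^{\frac12+\frac{\eta+q'+q+1}{1-q_+}}$ for all $p\ge2$, $t>0$, $f\in\mathcal F(\eta,\mathfrak L)$, and consequently $\mathbb P^\mu(|\mathbb G_t(f)|>\mathrm e\mathfrak L\mathfrak W u^{\frac12+\frac{\eta+q'+q+1}{1-q_+}})\le\mathrm e^{-u}$ for $u\ge2$ (such a constant exists). Sample length function: if $\eta=0$, $\Psi(\varepsilon,\delta)=\Big(\dfrac{c(q,\iota'')^{-1}(\log(2/\delta))^{1/(1-q_+)}+1}{1\wedge\varepsilon/(2\mathfrak L)}\Big)^2$; if $\eta>0$, $\Psi(\varepsilon,\delta)=\Big(\dfrac{\mathrm e\mathfrak L\mathfrak W(\log(1/\delta))^{\frac12+\frac{\eta+q'+q+1}{1-q_+}}}{\varepsilon}\Big)^2$. *)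

theory Defs
  imports "HOL-Probability.Probability"
begin

section \<open>Conventions\<close>

abbreviation qpos :: "real \<Rightarrow> real" where
  "qpos q \<equiv> max q 0"

text \<open>
  Power of a nonnegative real with the convention \<open>0 ^ 0 = 1\<close>; the library operator has
  \<open>0 powr 0 = 0\<close>, which would tighten the growth condition \<open>1 + norm x ^ \<eta>\<close> at \<open>x = 0\<close>, \<open>\<eta> = 0\<close>.
\<close>
definition pow0 :: "real \<Rightarrow> real \<Rightarrow> real" where
  "pow0 r s = (if s = 0 then 1 else r powr s)"

definition tv_dist :: "('a::topological_space) measure \<Rightarrow> 'a measure \<Rightarrow> real" where
  "tv_dist M N =
     (SUP g \<in> {g \<in> borel_measurable borel. \<forall>x. \<bar>g x :: real\<bar> \<le> 1}. \<bar>(LINT x|M. g x) - (LINT x|N. g x)\<bar>)"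

definition converges_in_prob ::
  "'w measure \<Rightarrow> (nat \<Rightarrow> 'w \<Rightarrow> 'a::metric_space) \<Rightarrow> ('w \<Rightarrow> 'a) \<Rightarrow> bool" where
  "converges_in_prob M Y Z \<longleftrightarrow>
     (\<forall>e>0. (\<lambda>n. measure M {w \<in> space M. dist (Y n w) (Z w) > e}) \<longlonglongrightarrow> 0)"

section \<open>Brownian motion, Ito integral, weak solutions\<close>

text \<open>
  The time axis is \<open>[0, \<infinity>)\<close>; filtrations and processes are indexed by all of \<open>real\<close>, and their
  values at negative times play no role.
\<close>

definition brownian_motion ::
  "'w measure \<Rightarrow> (real \<Rightarrow> 'w measure) \<Rightarrow> (real \<Rightarrow> 'w \<Rightarrow> real ^ 'd) \<Rightarrow> bool" where
  "brownian_motion M F W \<longleftrightarrow>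
     (\<forall>t\<ge>0. W t \<in> borel_measurable (F t)) \<and>
     (AE w in M. W 0 w = 0) \<and>
     (\<forall>w\<in>space M. continuous_on {0..} (\<lambda>t. W t w)) \<and>
     (\<forall>s t. 0 \<le> s \<and> s < t \<longrightarrow>
        distributed M lborel (\<lambda>w. W t w - W s w)
          (\<lambda>y. ennreal (\<Prod>i\<in>UNIV. normal_density 0 (sqrt (t - s)) (y $ i))) \<and>
        prob_space.indep_set M (sets (F s))
          (sets (vimage_algebra (space M) (\<lambda>w. W t w - W s w) borel)))"

definition simple_integrand ::
  "(real \<Rightarrow> 'w measure) \<Rightarrow> real \<Rightarrow> nat \<Rightarrow> (nat \<Rightarrow> real) \<Rightarrow> (nat \<Rightarrow> 'w \<Rightarrow> real ^ 'd ^ 'd) \<Rightarrow> bool" where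
  "simple_integrand F t k \<tau> \<xi> \<longleftrightarrow>
     \<tau> 0 = 0 \<and> \<tau> k = t \<and>
     (\<forall>i<k. \<tau> i \<le> \<tau> (Suc i) \<and> \<xi> i \<in> borel_measurable (F (\<tau> i)) \<and> bounded (\<xi> i ` space (F (\<tau> i))))"

definition simple_process ::
  "nat \<Rightarrow> (nat \<Rightarrow> real) \<Rightarrow> (nat \<Rightarrow> 'w \<Rightarrow> real ^ 'd ^ 'd) \<Rightarrow> real \<Rightarrow> 'w \<Rightarrow> real ^ 'd ^ 'd" where
  "simple_process k \<tau> \<xi> s w = (\<Sum>i<k. indicator {\<tau> i<..\<tau> (Suc i)} s *\<^sub>R \<xi> i w)"

definition simple_integral ::
  "nat \<Rightarrow> (nat \<Rightarrow> real) \<Rightarrow> (nat \<Rightarrow> 'w \<Rightarrow> real ^ 'd ^ 'd) \<Rightarrow> (real \<Rightarrow> 'w \<Rightarrow> real ^ 'd) \<Rightarrow> 'w \<Rightarrow> real ^ 'd" where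
  "simple_integral k \<tau> \<xi> W w = (\<Sum>i<k. \<xi> i w *v (W (\<tau> (Suc i)) w - W (\<tau> i) w))"

text \<open>
  \<open>J\<close> is (a version of) the Ito integral of \<open>H\<close> against \<open>W\<close> over \<open>[0, t]\<close>: the limit in probability of
  the integrals of simple processes \<open>H\<^sub>n\<close> with \<open>\<integral>\<^sub>0\<^sup>t \<parallel>H - H\<^sub>n\<parallel>\<^sup>2 ds \<longlonglongrightarrow> 0\<close> in probability.
\<close>
definition is_ito_integral ::
  "'w measure \<Rightarrow> (real \<Rightarrow> 'w measure) \<Rightarrow> (real \<Rightarrow> 'w \<Rightarrow> real ^ 'd) \<Rightarrow> (real \<Rightarrow> 'w \<Rightarrow> real ^ 'd ^ 'd)
     \<Rightarrow> real \<Rightarrow> ('w \<Rightarrow> real ^ 'd) \<Rightarrow> bool" where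
  "is_ito_integral M F W H t J \<longleftrightarrow>
     J \<in> borel_measurable M \<and>
     (\<exists>k \<tau> \<xi>.
        (\<forall>n. simple_integrand F t (k n) (\<tau> n) (\<xi> n)) \<and>
        (\<forall>e>0. (\<lambda>n. measure M {w \<in> space M.
           (\<integral>\<^sup>+ s \<in> {0..t}. ennreal ((norm (H s w - simple_process (k n) (\<tau> n) (\<xi> n) s w))\<^sup>2) \<partial>lborel)
             > ennreal e}) \<longlonglongrightarrow> 0) \<and>
        converges_in_prob M (\<lambda>n. simple_integral (k n) (\<tau> n) (\<xi> n) W) J)"

definition weak_solution ::
  "'w measure \<Rightarrow> (real \<Rightarrow> 'w measure) \<Rightarrow> (real ^ 'd \<Rightarrow> real ^ 'd) \<Rightarrow> (real ^ 'd \<Rightarrow> real ^ 'd ^ 'd)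
     \<Rightarrow> (real \<Rightarrow> 'w \<Rightarrow> real ^ 'd) \<Rightarrow> (real \<Rightarrow> 'w \<Rightarrow> real ^ 'd) \<Rightarrow> bool" where
  "weak_solution M F b \<sigma> X W \<longleftrightarrow>
     prob_space M \<and> filtration (space M) F \<and> (\<forall>t\<ge>0. subalgebra M (F t)) \<and>
     brownian_motion M F W \<and>
     (\<forall>t\<ge>0. X t \<in> borel_measurable (F t)) \<and>
     (\<forall>w\<in>space M. continuous_on {0..} (\<lambda>t. X t w)) \<and>
     (\<forall>t\<ge>0. \<exists>J. is_ito_integral M F W (\<lambda>s w. \<sigma> (X s w)) t J \<and>
        (AE w in M. X t w = X 0 w + (LINT s:{0..t}|lborel. b (X s w)) + J w))"

section \<open>The Markovian weak solution\<close>

definition natural_filtration :: "'w measure \<Rightarrow> (real \<Rightarrow> 'w \<Rightarrow> 'a::topological_space) \<Rightarrow> real \<Rightarrow> 'w measure" where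
  "natural_filtration S X t =
     sigma (space S) {X s -` A \<inter> space S |s A. 0 \<le> s \<and> s \<le> t \<and> A \<in> sets borel}"

text \<open>
  A family \<open>(P x)\<close> of laws on the measurable space \<open>S\<close> (the measure carried by \<open>S\<close> is irrelevant).
  The driving Brownian motion and its filtration may depend on \<open>x\<close> and may use \<open>P x\<close>-null sets, hence
  the completion.
\<close>
definition markovian_weak_solution ::
  "'w measure \<Rightarrow> (real ^ 'd \<Rightarrow> real ^ 'd) \<Rightarrow> (real ^ 'd \<Rightarrow> real ^ 'd ^ 'd)
     \<Rightarrow> (real \<Rightarrow> 'w \<Rightarrow> real ^ 'd) \<Rightarrow> (real ^ 'd \<Rightarrow> 'w measure) \<Rightarrow> bool" where
  "markovian_weak_solution S b \<sigma> X P \<longleftrightarrow>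
     (\<forall>t\<ge>0. X t \<in> borel_measurable S) \<and>
     (\<forall>w\<in>space S. continuous_on {0..} (\<lambda>t. X t w)) \<and>
     P \<in> borel \<rightarrow>\<^sub>M prob_algebra S \<and>
     (\<forall>x. AE w in P x. X 0 w = x) \<and>
     (\<forall>x. \<exists>F W. weak_solution (completion (P x)) F b \<sigma> X W) \<and>
     (\<forall>x. \<forall>s\<ge>0. \<forall>t\<ge>0. \<forall>A\<in>sets borel. AE w in P x.
        real_cond_exp (P x) (natural_filtration S X s) (indicator {w \<in> space S. X (s + t) w \<in> A}) w
          = measure (P (X s w)) {w' \<in> space S. X t w' \<in> A})"

text \<open>\<open>\<nu> \<bind> P\<close> is the law \<open>\<integral> P x \<nu>(dx)\<close> with initial distribution \<open>\<nu>\<close>.\<close>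
definition invariant_distribution ::
  "(real \<Rightarrow> 'w \<Rightarrow> real ^ 'd) \<Rightarrow> (real ^ 'd \<Rightarrow> 'w measure) \<Rightarrow> (real ^ 'd) measure \<Rightarrow> bool" where
  "invariant_distribution X P \<mu> \<longleftrightarrow>
     prob_space \<mu> \<and> sets \<mu> = sets borel \<and> (\<forall>t\<ge>0. distr (\<mu> \<bind> P) borel (X t) = \<mu>)"

definition diffusion_matrix :: "(real ^ 'd \<Rightarrow> real ^ 'd ^ 'd) \<Rightarrow> real ^ 'd \<Rightarrow> real ^ 'd ^ 'd" where
  "diffusion_matrix \<sigma> x = \<sigma> x ** transpose (\<sigma> x)"

definition locally_lipschitz :: "('a::metric_space \<Rightarrow> 'b::metric_space) \<Rightarrow> bool" where
  "locally_lipschitz f \<longleftrightarrow> local_lipschitz (UNIV :: real set) UNIV (\<lambda>_. f)"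

definition uniformly_elliptic :: "(real ^ 'd \<Rightarrow> real ^ 'd ^ 'd) \<Rightarrow> bool" where
  "uniformly_elliptic a \<longleftrightarrow> (\<exists>l>0. \<forall>x \<xi>. (a x *v \<xi>) \<bullet> \<xi> \<ge> l * (norm \<xi>)\<^sup>2)"

definition drift_condition ::
  "(real ^ 'd \<Rightarrow> real ^ 'd) \<Rightarrow> real \<Rightarrow> real \<Rightarrow> real \<Rightarrow> bool" where
  "drift_condition b q M\<^sub>0 \<rr> \<longleftrightarrow>
     (\<forall>x. x \<noteq> 0 \<and> norm x \<ge> M\<^sub>0 \<longrightarrow> b x \<bullet> (x /\<^sub>R norm x) \<le> - \<rr> * norm x powr (- q))"

section \<open>Function classes and averages\<close>

definition class_G :: "real \<Rightarrow> real \<Rightarrow> (real ^ 'd \<Rightarrow> real) set" where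
  "class_G \<eta> \<LL> = {f \<in> borel_measurable borel. \<forall>x. \<bar>f x\<bar> \<le> \<LL> * (1 + pow0 (norm x) \<eta>)}"

definition class_F :: "(real ^ 'd) measure \<Rightarrow> real \<Rightarrow> real \<Rightarrow> (real ^ 'd \<Rightarrow> real) set" where
  "class_F \<mu> \<eta> \<LL> = {\<lambda>x. f x - (LINT y|\<mu>. f y) |f. f \<in> class_G \<eta> \<LL>}"

definition scaled_avg :: "(real \<Rightarrow> 'w \<Rightarrow> 'a) \<Rightarrow> real \<Rightarrow> ('a \<Rightarrow> real) \<Rightarrow> 'w \<Rightarrow> real" where
  "scaled_avg X t f w = t powr (- 1/2) * (LINT s:{0..t}|lborel. f (X s w))"

definition burn_in_avg :: "(real \<Rightarrow> 'w \<Rightarrow> 'a) \<Rightarrow> real \<Rightarrow> real \<Rightarrow> ('a \<Rightarrow> real) \<Rightarrow> 'w \<Rightarrow> real" where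
  "burn_in_avg X v t f w = 1 / t * (LINT s:{v..v + t}|lborel. f (X s w))"

section \<open>Constants\<close>

definition lambda_plus :: "(real ^ 'd \<Rightarrow> real ^ 'd ^ 'd) \<Rightarrow> real" where
  "lambda_plus a = (LEAST l. \<forall>x. x \<noteq> 0 \<longrightarrow> (a x *v (x /\<^sub>R norm x)) \<bullet> (x /\<^sub>R norm x) \<le> l)"

definition V_fun :: "real \<Rightarrow> real \<Rightarrow> real ^ 'd \<Rightarrow> real" where
  "V_fun \<iota> q x = exp (\<iota> * norm x powr (1 - qpos q))"

definition iota' :: "real \<Rightarrow> real \<Rightarrow> real \<Rightarrow> real \<Rightarrow> real" where
  "iota' q \<iota> \<rr> l =
     \<iota> powr ((1 + qpos q) / (1 - qpos q)) * (1 + qpos q) * (\<rr> - l * \<iota> * (1 - qpos q) / 2)"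

definition c_const :: "real \<Rightarrow> real \<Rightarrow> real" where
  "c_const q \<iota>'' =
     1/2 * ((1 + qpos q) / (1 - qpos q)) powr (1 / (1 - qpos q))
         * ((1 - qpos q) * \<iota>'' / (1 + qpos q)) powr ((1 + qpos q) / (2 * (1 - qpos q)))"

definition tv_constant ::
  "(real \<Rightarrow> 'w \<Rightarrow> real ^ 'd) \<Rightarrow> (real ^ 'd \<Rightarrow> 'w measure) \<Rightarrow> (real ^ 'd) measure
     \<Rightarrow> real \<Rightarrow> real \<Rightarrow> real \<Rightarrow> real \<Rightarrow> bool" where
  "tv_constant X P \<mu> q \<iota> \<iota>' C \<longleftrightarrow>
     (\<forall>x. \<forall>t\<ge>0. tv_dist (distr (P x) borel (X t)) \<mu>
        \<le> C * V_fun \<iota> q x * (1 + t) powr (2 * qpos q / (1 + qpos q))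
            * exp (- ((\<iota>' * t) powr ((1 - qpos q) / (1 + qpos q)))))"

definition deviation_constant ::
  "(real \<Rightarrow> 'w \<Rightarrow> real ^ 'd) \<Rightarrow> (real ^ 'd \<Rightarrow> 'w measure) \<Rightarrow> (real ^ 'd) measure
     \<Rightarrow> real \<Rightarrow> real \<Rightarrow> real \<Rightarrow> real \<Rightarrow> bool" where
  "deviation_constant X P \<mu> q \<iota>'' \<LL> \<cc> \<longleftrightarrow>
     \<cc> > 0 \<and>
     (\<forall>f \<in> class_F \<mu> 0 \<LL>. \<forall>u>0. \<forall>t>0.
        \<cc> * (1 + qpos q) * (1 - qpos q) powr (- (1 - qpos q) / 2) \<le> u \<and>
        u < (c_const q \<iota>'' * of_int \<lfloor>t\<rfloor> / sqrt t) powr (1 - qpos q) \<longrightarrow>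
        measure (\<mu> \<bind> P) {w \<in> space (\<mu> \<bind> P).
            \<bar>scaled_avg X t f w\<bar>
              > 2 * \<LL> * (u powr (1 / (1 - qpos q)) / c_const q \<iota>'' + t powr (- 1/2))}
          \<le> 2 * exp (- u))"

definition moment_exponent :: "real \<Rightarrow> real \<Rightarrow> real \<Rightarrow> real" where
  "moment_exponent q q' \<eta> = 1/2 + (\<eta> + q' + q + 1) / (1 - qpos q)"

text \<open>The integrability clause says that the \<open>L\<^sup>p\<close>-norm is finite (a Bochner integral is 0 otherwise).\<close>
definition moment_constant ::
  "(real \<Rightarrow> 'w \<Rightarrow> real ^ 'd) \<Rightarrow> (real ^ 'd \<Rightarrow> 'w measure) \<Rightarrow> (real ^ 'd) measure
     \<Rightarrow> real \<Rightarrow> real \<Rightarrow> real \<Rightarrow> real \<Rightarrow> bool" where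
  "moment_constant X P \<mu> q q' \<eta> \<WW> \<longleftrightarrow>
     (\<forall>\<LL>>0. \<forall>f \<in> class_F \<mu> \<eta> \<LL>. \<forall>p\<ge>2. \<forall>t>0.
        integrable (\<mu> \<bind> P) (\<lambda>w. \<bar>scaled_avg X t f w\<bar> powr p) \<and>
        (LINT w|(\<mu> \<bind> P). \<bar>scaled_avg X t f w\<bar> powr p) powr (1 / p)
          \<le> \<LL> * \<WW> * p powr moment_exponent q q' \<eta>)"

definition Psi ::
  "real \<Rightarrow> real \<Rightarrow> real \<Rightarrow> real \<Rightarrow> real \<Rightarrow> real \<Rightarrow> real \<Rightarrow> real \<Rightarrow> real" where
  "Psi q q' \<eta> \<LL> \<iota>'' \<WW> \<epsilon> \<delta> =
     (if \<eta> = 0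
      then ((ln (2 / \<delta>) powr (1 / (1 - qpos q)) / c_const q \<iota>'' + 1) / min 1 (\<epsilon> / (2 * \<LL>)))\<^sup>2
      else (exp 1 * \<LL> * \<WW> * ln (1 / \<delta>) powr moment_exponent q q' \<eta> / \<epsilon>)\<^sup>2)"

end

theory Submission
  imports Defs
begin

text \<open>
  The error probability \<open>\<delta>\<close> is split in half between mixing during the burn-in and fluctuation of the
  stationary average.
  
  By the Markov property at time \<open>v\<close>, the probability that the burn-in average misses \<open>\<mu>(f)\<close> by more than
  \<open>\<epsilon>\<close> is \<open>\<integral> h d(law of X v)\<close>, where \<open>h y\<close> is the probability of the same event for the average over \<open>[0, t]\<close> of the
  process started in \<open>y\<close>. Replacing the law of \<open>X v\<close> by \<open>\<mu>\<close> costs at most the total variation distance,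
  because \<open>0 \<le> h \<le> 1\<close>; integrating the bound for this distance over the initial distribution gives
  \<open>C * exp (- (\<iota>'' v)\<^sup>\<kappa>)\<close> with \<open>\<kappa> = (1 - q\<^sub>+) / (1 + q\<^sub>+)\<close>, and the condition on \<open>v\<close> makes this at most \<open>\<delta> / 2\<close>
  (\<open>burn_in_deviation_bound\<close>, \<open>burn_in_factor_le\<close>). What remains is the stationary process, for which the
  sample length is chosen so that the deviation inequality (for bounded \<open>f\<close>) or the moment inequality
  (for \<open>f\<close> of polynomial growth) at level \<open>\<epsilon> * sqrt t\<close> yields the other \<open>\<delta> / 2\<close>
  (\<open>stationary_deviation_bound\<close>).
  
  The Markov property of a Markovian weak solution concerns a single future time, while \<open>h\<close> depends on
  the whole path over \<open>[0, t]\<close>. The bridge has two pieces: the property extends to finitely many future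
  times, hence to the law of the shifted path on the product algebra (\<open>finite_dimensional_markov\<close>,
  \<open>path_law_markov\<close>), and the time integral along a continuous path is a measurable function of the path
  for this algebra (\<open>time_integral_path_measurable\<close>).
\<close>

section \<open>The Markov property at finitely many times\<close>

text \<open>
  The part of being a Markovian weak solution that the argument below lives on: continuous paths
  and the Markov property for a single future time, stated through conditional probabilities given
  the natural filtration. Banach-valued states are convenient because limits of measurable
  functions into such a space are measurable.
\<close>
locale markov_family =
  fixes S :: "'w measure"
    and X :: "real \<Rightarrow> 'w \<Rightarrow> 'a::{banach, second_countable_topology}"
    and P :: "'a \<Rightarrow> 'w measure"
  assumes X_measurable: "0 \<le> t \<Longrightarrow> X t \<in> borel_measurable S"
    and X_continuous: "w \<in> space S \<Longrightarrow> continuous_on {0..} (\<lambda>t. X t w)"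
    and kernel: "P \<in> borel \<rightarrow>\<^sub>M prob_algebra S"
    and start: "AE w in P x. X 0 w = x"
    and markov: "0 \<le> s \<Longrightarrow> 0 \<le> t \<Longrightarrow> A \<in> sets borel \<Longrightarrow> AE w in P x.
        real_cond_exp (P x) (natural_filtration S X s) (indicator {w \<in> space S. X (s + t) w \<in> A}) w
          = measure (P (X s w)) {w' \<in> space S. X t w' \<in> A}"
begin

lemma prob_space_P [simp]: "prob_space (P x)"
  and sets_P [simp, measurable_cong]: "sets (P x) = sets S"
  using measurable_space[OF kernel, of x] by (auto simp: space_prob_algebra)

lemma space_P [simp]: "space (P x) = space S"
  by (rule sets_eq_imp_space_eq) simp

lemma kernel_subprob [measurable]: "P \<in> borel \<rightarrow>\<^sub>M subprob_algebra S"
  by (rule measurable_prob_algebraD[OF kernel])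

lemma X_P_measurable: "0 \<le> t \<Longrightarrow> X t \<in> borel_measurable (P x)"
  using X_measurable by (simp cong: measurable_cong_sets)

lemma space_natural_filtration: "space (natural_filtration S X s) = space S"
  unfolding natural_filtration_def by (rule space_measure_of) auto

lemma sets_natural_filtration: "sets (natural_filtration S X s) =
    sigma_sets (space S) {X r -` A \<inter> space S |r A. 0 \<le> r \<and> r \<le> s \<and> A \<in> sets borel}"
  unfolding natural_filtration_def by (rule sets_measure_of) auto

lemma natural_filtration_sets_subset: "sets (natural_filtration S X s) \<subseteq> sets S"
  unfolding sets_natural_filtration
  by (intro sets.sigma_sets_subset) (auto intro!: measurable_sets[OF X_measurable])

lemma natural_filtration_mono:
  "s \<le> s' \<Longrightarrow> sets (natural_filtration S X s) \<subseteq> sets (natural_filtration S X s')"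
  unfolding sets_natural_filtration by (rule sigma_sets_mono') fastforce

lemma X_event_in_natural_filtration:
  "0 \<le> r \<Longrightarrow> r \<le> s \<Longrightarrow> A \<in> sets borel \<Longrightarrow>
    {w \<in> space S. X r w \<in> A} \<in> sets (natural_filtration S X s)"
  unfolding sets_natural_filtration
  by (rule sigma_sets.Basic) (auto simp: vimage_def Int_def conj_commute)

lemma prob_space_law: "0 \<le> t \<Longrightarrow> prob_space (distr (P x) borel (X t))"
  by (intro prob_space.prob_space_distr X_P_measurable prob_space_P)

lemma transition_measurable:
  "0 \<le> t \<Longrightarrow> (\<lambda>y. distr (P y) borel (X t)) \<in> borel \<rightarrow>\<^sub>M prob_algebra borel"
  by (rule measurable_compose[OF kernel measurable_distr_prob_space[OF X_measurable]])

text \<open>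
  The defining property of conditional expectation turns the almost sure Markov identity into an
  identity of integrals over \<open>B\<close>, in which conditional expectations no longer occur.
\<close>
lemma markov_event:
  assumes s: "0 \<le> s" and t: "0 \<le> t" and A: "A \<in> sets borel"
    and B: "B \<in> sets (natural_filtration S X s)"
  shows "emeasure (P x) (B \<inter> {w \<in> space S. X (s + t) w \<in> A}) =
    (\<integral>\<^sup>+w. emeasure (P (X s w)) {w' \<in> space S. X t w' \<in> A} * indicator B w \<partial>P x)"
proof -
  interpret prob_space "P x" by simp
  let ?F = "natural_filtration S X s"
  let ?E = "{w \<in> space S. X (s + t) w \<in> A}"
  have "subalgebra (P x) ?F"
    using natural_filtration_sets_subset by (simp add: subalgebra_def space_natural_filtration)
  then interpret finite_measure_subalgebra "P x" ?F
    by unfold_locales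
  have [measurable]: "X (s + t) \<in> borel_measurable S" "X s \<in> borel_measurable S" "X t \<in> borel_measurable S"
    using s t by (auto intro!: X_measurable)
  note A[measurable]
  have [measurable]: "B \<in> sets S" using B natural_filtration_sets_subset by auto
  have E[measurable]: "?E \<in> sets S" "{w' \<in> space S. X t w' \<in> A} \<in> sets S"
    by measurable
  have m[measurable]: "(\<lambda>w. measure (P (X s w)) {w' \<in> space S. X t w' \<in> A}) \<in> borel_measurable S"
    by (rule measurable_compose[OF measurable_compose[OF _ kernel_subprob] measurable_measure_subprob_algebra]) auto
  have "measure (P x) (B \<inter> ?E) = (LINT w:B|P x. indicator ?E w)"
    by (simp add: set_lebesgue_integral_def indicator_inter_arith[symmetric] Int_absorb2 sets.sets_into_space)
  also have "\<dots> = (LINT w:B|P x. real_cond_exp (P x) ?F (indicator ?E) w)"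
    by (rule real_cond_exp_intA[OF _ B]) (auto simp: emeasure_eq_measure)
  also have "\<dots> = (LINT w:B|P x. measure (P (X s w)) {w' \<in> space S. X t w' \<in> A})"
    unfolding set_lebesgue_integral_def
    by (rule integral_cong_AE) (use markov[OF s t A, of x] in auto)
  also have "\<dots> = (LINT w|P x. measure (P (X s w)) {w' \<in> space S. X t w' \<in> A} * indicator B w)"
    by (simp add: set_lebesgue_integral_def mult.commute)
  finally have "emeasure (P x) (B \<inter> ?E) =
      ennreal (LINT w|P x. measure (P (X s w)) {w' \<in> space S. X t w' \<in> A} * indicator B w)"
    by (simp add: emeasure_eq_measure)
  also have "\<dots> = (\<integral>\<^sup>+w. ennreal (measure (P (X s w)) {w' \<in> space S. X t w' \<in> A} * indicator B w) \<partial>P x)"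
    by (intro nn_integral_eq_integral[symmetric] integrable_const_bound[where B=1])
       (auto simp: indicator_def prob_space.prob_le_1)
  also have "\<dots> = (\<integral>\<^sup>+w. emeasure (P (X s w)) {w' \<in> space S. X t w' \<in> A} * indicator B w \<partial>P x)"
    by (intro nn_integral_cong)
       (auto simp: indicator_def finite_measure.emeasure_eq_measure prob_space.finite_measure)
  finally show ?thesis .
qed

text \<open>
  Both sides are integrals of \<open>h\<close> against finite measures on the state space: the law of \<open>X (s + t)\<close>
  restricted to \<open>B\<close>, and the law of \<open>X s\<close> restricted to \<open>B\<close> composed with the transition kernel.
  The Markov property for events says that these two measures agree.
\<close>
lemma markov_nn_integral:
  assumes s: "0 \<le> s" and t: "0 \<le> t" and B: "B \<in> sets (natural_filtration S X s)"
    and h [measurable]: "h \<in> borel_measurable borel"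
  shows "(\<integral>\<^sup>+w. h (X (s + t) w) * indicator B w \<partial>P x) =
    (\<integral>\<^sup>+w. (\<integral>\<^sup>+w'. h (X t w') \<partial>P (X s w)) * indicator B w \<partial>P x)"
proof -
  interpret prob_space "P x" by simp
  have [measurable]: "X (s + t) \<in> borel_measurable S" "X s \<in> borel_measurable S" "X t \<in> borel_measurable S"
    using s t by (auto intro!: X_measurable)
  have [measurable]: "B \<in> sets S" using B natural_filtration_sets_subset by auto
  define R where "R = density (P x) (indicator B)"
  have sR [simp, measurable_cong]: "sets R = sets S" by (simp add: R_def)
  have spR [simp]: "space R = space S" by (simp add: R_def)
  have ne: "space S \<noteq> {}" using not_empty by simp
  let ?T = "\<lambda>y. distr (P y) borel (X t)"
  have T[measurable]: "?T \<in> borel \<rightarrow>\<^sub>M subprob_algebra borel"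
    by (rule measurable_prob_algebraD[OF transition_measurable[OF t]])
  have eq: "distr R borel (X (s + t)) = distr R borel (X s) \<bind> ?T"
  proof (rule measure_eqI)
    fix A assume "A \<in> sets (distr R borel (X (s + t)))"
    then have A[measurable]: "A \<in> sets borel" by simp
    have "emeasure (distr R borel (X (s + t))) A = emeasure R {w \<in> space S. X (s + t) w \<in> A}"
      by (subst emeasure_distr) (auto simp: vimage_def Int_def conj_commute intro!: arg_cong2[where f=emeasure])
    also have "\<dots> = emeasure (P x) (B \<inter> {w \<in> space S. X (s + t) w \<in> A})"
      unfolding R_def
      by (subst emeasure_density) (auto simp flip: indicator_inter_arith)
    also have "\<dots> = (\<integral>\<^sup>+w. emeasure (P (X s w)) {w' \<in> space S. X t w' \<in> A} * indicator B w \<partial>P x)"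
      by (rule markov_event[OF s t A B])
    also have "\<dots> = (\<integral>\<^sup>+w. emeasure (?T (X s w)) A \<partial>R)"
    proof -
      have *: "emeasure (?T y) A = emeasure (P y) {w' \<in> space S. X t w' \<in> A}" for y
        by (subst emeasure_distr) (auto simp: vimage_def Int_def conj_commute intro!: arg_cong2[where f=emeasure])
      have "(\<lambda>w. emeasure (?T (X s w)) A) \<in> borel_measurable S"
        by measurable
      then show ?thesis
        unfolding R_def by (subst nn_integral_density) (auto simp: * mult.commute)
    qed
    also have "\<dots> = emeasure (distr R borel (X s) \<bind> ?T) A"
      by (subst emeasure_bind[where N=borel]) (auto simp: nn_integral_distr ne)
    finally show "emeasure (distr R borel (X (s + t))) A = emeasure (distr R borel (X s) \<bind> ?T) A" .
  qed (simp add: sets_bind[where N=borel] ne)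
  have "(\<integral>\<^sup>+w. h (X (s + t) w) * indicator B w \<partial>P x) = (\<integral>\<^sup>+y. h y \<partial>distr R borel (X (s + t)))"
    by (subst nn_integral_distr) (auto simp: R_def nn_integral_density mult.commute)
  also have "\<dots> = (\<integral>\<^sup>+y. \<integral>\<^sup>+z. h z \<partial>?T y \<partial>distr R borel (X s))"
    unfolding eq by (rule nn_integral_bind[OF h]) (use T in simp)
  also have "\<dots> = (\<integral>\<^sup>+w. (\<integral>\<^sup>+z. h z \<partial>?T (X s w)) \<partial>R)"
    by (rule nn_integral_distr) (auto intro!: measurable_compose[OF T nn_integral_measurable_subprob_algebra])
  also have "\<dots> = (\<integral>\<^sup>+w. (\<integral>\<^sup>+w'. h (X t w') \<partial>P (X s w)) \<partial>R)"
    by (intro nn_integral_cong nn_integral_distr) auto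
  also have "\<dots> = (\<integral>\<^sup>+w. (\<integral>\<^sup>+w'. h (X t w') \<partial>P (X s w)) * indicator B w \<partial>P x)"
  proof -
    have "(\<lambda>y. \<integral>\<^sup>+w'. h (X t w') \<partial>P y) \<in> borel_measurable borel"
      by (rule measurable_compose[OF kernel_subprob nn_integral_measurable_subprob_algebra]) auto
    then have "(\<lambda>w. \<integral>\<^sup>+w'. h (X t w') \<partial>P (X s w)) \<in> borel_measurable S"
      by measurable
    then show ?thesis
      unfolding R_def by (subst nn_integral_density) (auto simp: mult.commute)
  qed
  finally show ?thesis .
qed

text \<open>
  Several future times are handled by removing the smallest one: the constraint at that time \<open>r\<close> is
  absorbed into the past event \<open>B\<close>, the remaining times are then in the future of \<open>r\<close>, and the
  resulting function of \<open>X (v + r)\<close> is pulled back to time \<open>v + s\<close> by the Markov property. What makes the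
  induction useful is the order of the quantifiers: one function \<open>g\<close> serves all starting points \<open>x\<close>
  and all shifts \<open>v\<close> at once, so that cylinder probabilities with and without a shift can be compared.
\<close>
lemma finite_dimensional_markov:
  assumes "finite J" and "\<And>j. j \<in> J \<Longrightarrow> A j \<in> sets borel" and "0 \<le> s" and "\<And>j. j \<in> J \<Longrightarrow> s \<le> j"
  shows "\<exists>g\<in>borel_measurable borel. \<forall>x. \<forall>v\<ge>0. \<forall>B\<in>sets (natural_filtration S X (v + s)).
    emeasure (P x) (B \<inter> {w \<in> space S. \<forall>j\<in>J. X (v + j) w \<in> A j}) =
      (\<integral>\<^sup>+w. g (X (v + s) w) * indicator B w \<partial>P x)"
  using assms
proof (induction J arbitrary: s rule: finite_linorder_min_induct)
  case empty
  show ?case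
  proof (intro bexI[of _ "\<lambda>_. 1"] allI impI ballI)
    fix x v B assume B: "B \<in> sets (natural_filtration S X (v + s))"
    then have "B \<in> sets S" using natural_filtration_sets_subset by auto
    then show "emeasure (P x) (B \<inter> {w \<in> space S. \<forall>j\<in>{}. X (v + j) w \<in> A j}) =
      (\<integral>\<^sup>+w. 1 * indicator B w \<partial>P x)"
      by (simp add: Int_absorb2 sets.sets_into_space)
  qed simp
next
  case (insert r J)
  have r: "0 \<le> r" "s \<le> r" using insert.prems by (force)+
  obtain g where g[measurable]: "g \<in> borel_measurable borel" and
    IH: "\<And>x v B. v \<ge> 0 \<Longrightarrow> B \<in> sets (natural_filtration S X (v + r)) \<Longrightarrow>
      emeasure (P x) (B \<inter> {w \<in> space S. \<forall>j\<in>J. X (v + j) w \<in> A j}) =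
        (\<integral>\<^sup>+w. g (X (v + r) w) * indicator B w \<partial>P x)"
    using insert.IH[of r] insert.prems insert.hyps r by (meson insertCI less_imp_le)
  have A[measurable]: "A r \<in> sets borel" using insert.prems by auto
  have [measurable]: "X (r - s) \<in> borel_measurable S" using r by (auto intro!: X_measurable)
  show ?case
  proof (intro bexI[of _ "\<lambda>y. \<integral>\<^sup>+w. g (X (r - s) w) * indicator (A r) (X (r - s) w) \<partial>P y"] allI impI ballI)
    show "(\<lambda>y. \<integral>\<^sup>+w. g (X (r - s) w) * indicator (A r) (X (r - s) w) \<partial>P y) \<in> borel_measurable borel"
      by (rule measurable_compose[OF kernel_subprob nn_integral_measurable_subprob_algebra]) auto
    fix x v B assume v: "(0::real) \<le> v" and B: "B \<in> sets (natural_filtration S X (v + s))"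
    define B' where "B' = B \<inter> {w \<in> space S. X (v + r) w \<in> A r}"
    have B': "B' \<in> sets (natural_filtration S X (v + r))"
      unfolding B'_def
      by (rule sets.Int)
         (use B r v natural_filtration_mono[of "v + s" "v + r"] in
           \<open>auto intro!: X_event_in_natural_filtration A\<close>)
    have "emeasure (P x) (B \<inter> {w \<in> space S. \<forall>j\<in>insert r J. X (v + j) w \<in> A j}) =
        emeasure (P x) (B' \<inter> {w \<in> space S. \<forall>j\<in>J. X (v + j) w \<in> A j})"
      by (rule arg_cong2[where f=emeasure]) (auto simp: B'_def)
    also have "\<dots> = (\<integral>\<^sup>+w. g (X (v + r) w) * indicator B' w \<partial>P x)"
      by (rule IH[OF v B'])
    also have "\<dots> = (\<integral>\<^sup>+w. g (X (v + s + (r - s)) w) * indicator (A r) (X (v + s + (r - s)) w) * indicator B w \<partial>P x)"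
      by (intro nn_integral_cong) (auto simp: B'_def indicator_def)
    also have "\<dots> = (\<integral>\<^sup>+w. (\<integral>\<^sup>+w'. g (X (r - s) w') * indicator (A r) (X (r - s) w') \<partial>P (X (v + s) w))
        * indicator B w \<partial>P x)"
      by (rule markov_nn_integral[where h="\<lambda>y. g y * indicator (A r) y"])
         (use insert.prems r v B in auto)
    finally show "emeasure (P x) (B \<inter> {w \<in> space S. \<forall>j\<in>insert r J. X (v + j) w \<in> A j}) =
      (\<integral>\<^sup>+w. (\<integral>\<^sup>+w'. g (X (r - s) w') * indicator (A r) (X (r - s) w') \<partial>P (X (v + s) w))
        * indicator B w \<partial>P x)" .
  qed
qed

text \<open>
  Taking \<open>v = 0\<close> identifies the anonymous function \<open>g\<close> of the previous lemma as the cylinder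
  probability under \<open>P y\<close>, because \<open>P y\<close> starts at \<open>y\<close>.
\<close>
lemma cylinder_markov:
  assumes J: "finite J" "J \<subseteq> {0..}" and A: "\<And>j. j \<in> J \<Longrightarrow> A j \<in> sets borel" and v: "0 \<le> v"
  shows "emeasure (P x) {w \<in> space S. \<forall>j\<in>J. X (v + j) w \<in> A j} =
    (\<integral>\<^sup>+w. emeasure (P (X v w)) {w' \<in> space S. \<forall>j\<in>J. X j w' \<in> A j} \<partial>P x)"
proof -
  have "\<exists>g\<in>borel_measurable borel. \<forall>x. \<forall>v\<ge>0. \<forall>B\<in>sets (natural_filtration S X (v + 0)).
    emeasure (P x) (B \<inter> {w \<in> space S. \<forall>j\<in>J. X (v + j) w \<in> A j}) =
      (\<integral>\<^sup>+w. g (X (v + 0) w) * indicator B w \<partial>P x)"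
    by (rule finite_dimensional_markov) (use J A in auto)
  then obtain g where g[measurable]: "g \<in> borel_measurable borel" and
    eq: "\<And>x v B. v \<ge> 0 \<Longrightarrow> B \<in> sets (natural_filtration S X v) \<Longrightarrow>
      emeasure (P x) (B \<inter> {w \<in> space S. \<forall>j\<in>J. X (v + j) w \<in> A j}) =
        (\<integral>\<^sup>+w. g (X v w) * indicator B w \<partial>P x)"
    unfolding add_0_right by blast
  have top: "space S \<in> sets (natural_filtration S X u)" for u
    by (metis sets.top space_natural_filtration)
  have eq': "emeasure (P x) {w \<in> space S. \<forall>j\<in>J. X (u + j) w \<in> A j} = (\<integral>\<^sup>+w. g (X u w) \<partial>P x)"
    if "0 \<le> u" for x u
  proof -
    have "emeasure (P x) {w \<in> space S. \<forall>j\<in>J. X (u + j) w \<in> A j} = (\<integral>\<^sup>+w. g (X u w) * indicator (space S) w \<partial>P x)"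
    proof -
      have "space S \<inter> {w \<in> space S. \<forall>j\<in>J. X (u + j) w \<in> A j} = {w \<in> space S. \<forall>j\<in>J. X (u + j) w \<in> A j}"
        by blast
      then show ?thesis using eq[OF that top, of x] by (simp only:)
    qed
    also have "\<dots> = (\<integral>\<^sup>+w. g (X u w) \<partial>P x)" by (intro nn_integral_cong) auto
    finally show ?thesis .
  qed
  have "emeasure (P y) {w' \<in> space S. \<forall>j\<in>J. X j w' \<in> A j} = g y" for y
  proof -
    interpret prob_space "P y" by simp
    have "emeasure (P y) {w' \<in> space S. \<forall>j\<in>J. X j w' \<in> A j} = (\<integral>\<^sup>+w. g (X 0 w) \<partial>P y)"
      using eq'[of 0 y] by (simp only: add_0_left order_refl)
    also have "\<dots> = (\<integral>\<^sup>+w. g y \<partial>P y)" by (intro nn_integral_cong_AE) (use start[of y] in auto)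
    finally show ?thesis using emeasure_space_1 by simp
  qed
  then show ?thesis using eq'[OF v] by (simp only:)
qed

end

section \<open>Time integrals and total variation\<close>

abbreviation path_algebra :: "(real \<Rightarrow> 'a::topological_space) measure" where
  "path_algebra \<equiv> PiM {0..} (\<lambda>_. borel)"

text \<open>
  Evaluation \<open>(s, \<omega>) \<mapsto> \<omega> s\<close> is in general not jointly measurable on the uncountable product. Evaluation along the grid of
  mesh \<open>1 / Suc n\<close> is, since only countably many coordinates enter, and its limit agrees with \<open>\<omega> s\<close> for
  continuous paths. Integrating \<open>f\<close> of this limit gives the measurable functional.
\<close>
lemma time_integral_path_measurable:
  fixes f :: "'a::{banach, second_countable_topology} \<Rightarrow> real"
  assumes f [measurable]: "f \<in> borel_measurable borel"
  obtains \<Phi> where "\<Phi> \<in> borel_measurable (path_algebra :: (real \<Rightarrow> 'a) measure)"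
    "\<And>\<omega>. continuous_on {0..} \<omega> \<Longrightarrow> \<Phi> (restrict \<omega> {0..}) = (LINT s:{0..t}|lborel. f (\<omega> s))"
proof -
  \<comment> \<open>\<open>r n s\<close> rounds \<open>s\<close> down to the grid; passing through \<open>nat\<close> keeps it in the index set \<open>{0..}\<close> for
    negative \<open>s\<close> as well.\<close>
  define r where "r n s = real (nat \<lfloor>real (Suc n) * s\<rfloor>) / real (Suc n)" for n and s :: real
  define Z where "Z s \<omega> = lim (\<lambda>n. \<omega> (r n s))" for s and \<omega> :: "real \<Rightarrow> 'a"
  have r_nonneg: "0 \<le> r n s" for n s by (simp add: r_def)
  have r_lim: "(\<lambda>n. r n s) \<longlonglongrightarrow> s" if s: "0 \<le> s" for s
  proof (rule tendsto_sandwich)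
    have fl: "real (nat \<lfloor>real (Suc n) * s\<rfloor>) = of_int \<lfloor>real (Suc n) * s\<rfloor>" for n
      using s by (intro of_nat_nat) simp
    show "\<forall>\<^sub>F n in sequentially. s - inverse (real (Suc n)) \<le> r n s"
    proof (intro always_eventually allI)
      fix n
      have "real (Suc n) * s - 1 \<le> of_int \<lfloor>real (Suc n) * s\<rfloor>" by linarith
      then have "(real (Suc n) * s - 1) / real (Suc n) \<le> r n s"
        unfolding r_def fl by (intro divide_right_mono) auto
      then show "s - inverse (real (Suc n)) \<le> r n s"
        by (simp add: diff_divide_distrib inverse_eq_divide)
    qed
    show "\<forall>\<^sub>F n in sequentially. r n s \<le> s"
    proof (intro always_eventually allI)
      fix n
      have "of_int \<lfloor>real (Suc n) * s\<rfloor> \<le> real (Suc n) * s" by linarith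
      then have "r n s \<le> real (Suc n) * s / real (Suc n)"
        unfolding r_def fl by (intro divide_right_mono) auto
      then show "r n s \<le> s" by simp
    qed
    show "(\<lambda>n. s - inverse (real (Suc n))) \<longlonglongrightarrow> s"
      using tendsto_diff[OF tendsto_const LIMSEQ_inverse_real_of_nat, of s] by simp
  qed simp
  have Z_cont: "Z s (restrict \<omega> {0..}) = \<omega> s" if "continuous_on {0..} \<omega>" "0 \<le> s" for s \<omega>
  proof -
    have "(\<lambda>n. \<omega> (r n s)) \<longlonglongrightarrow> \<omega> s"
      by (rule continuous_on_tendsto_compose[OF that(1) r_lim[OF that(2)]]) (use that r_nonneg in auto)
    then show ?thesis unfolding Z_def by (simp add: r_nonneg limI)
  qed
  have Z_meas [measurable]: "(\<lambda>(\<omega>, s). Z s \<omega>) \<in> borel_measurable (path_algebra \<Otimes>\<^sub>M lborel)"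
  proof -
    have "(\<lambda>x. fst x (r n (snd x)) :: 'a) \<in> borel_measurable (path_algebra \<Otimes>\<^sub>M lborel)" for n
    proof -
      have c: "(\<lambda>x. fst x (real k / real (Suc n)) :: 'a) \<in> borel_measurable (path_algebra \<Otimes>\<^sub>M lborel)" for k
        by (rule measurable_compose[OF measurable_fst measurable_component_singleton]) simp
      have "(\<lambda>x. nat \<lfloor>real (Suc n) * snd x\<rfloor>) \<in> path_algebra \<Otimes>\<^sub>M lborel \<rightarrow>\<^sub>M count_space UNIV"
        by measurable
      from measurable_compose_countable[OF c this] show ?thesis by (simp add: r_def)
    qed
    then show ?thesis unfolding Z_def case_prod_beta by (rule borel_measurable_lim_metric)
  qed
  show ?thesis
  proof
    show "(\<lambda>\<omega>. LINT s:{0..t}|lborel. f (Z s \<omega>)) \<in> borel_measurable (path_algebra :: (real \<Rightarrow> 'a) measure)"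
      unfolding set_lebesgue_integral_def by measurable
    show "(LINT s:{0..t}|lborel. f (Z s (restrict \<omega> {0..}))) = (LINT s:{0..t}|lborel. f (\<omega> s))"
      if "continuous_on {0..} \<omega>" for \<omega>
      by (rule set_lebesgue_integral_cong) (use Z_cont[OF that] in auto)
  qed
qed

lemma set_integral_shift:
  fixes g :: "real \<Rightarrow> real"
  shows "(LINT s:{v..v + t}|lborel. g s) = (LINT s:{0..t}|lborel. g (v + s))"
proof -
  have "(LINT s:{v..v + t}|lborel. g s) = (\<integral>s. indicator {v..v + t} (v + s) *\<^sub>R g (v + s) \<partial>lborel)"
    using lborel_integral_real_affine[of 1 "\<lambda>s. indicator {v..v + t} s *\<^sub>R g s" v]
    by (simp add: set_lebesgue_integral_def)
  also have "\<dots> = (LINT s:{0..t}|lborel. g (v + s))"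
    unfolding set_lebesgue_integral_def by (intro Bochner_Integration.integral_cong) (auto simp: indicator_def)
  finally show ?thesis .
qed

text \<open>
  The supremum defining \<open>tv_dist\<close> is a supremum of reals, so it dominates its members only once the
  family is known to be bounded; for probability measures 2 is a bound.
\<close>
lemma integral_diff_le_tv_dist:
  fixes g :: "'a::topological_space \<Rightarrow> real"
  assumes M: "prob_space M" "sets M = sets borel" and N: "prob_space N" "sets N = sets borel"
    and g: "g \<in> borel_measurable borel" "\<And>x. \<bar>g x\<bar> \<le> 1"
  shows "\<bar>(LINT x|M. g x) - (LINT x|N. g x)\<bar> \<le> tv_dist M N"
proof -
  let ?G = "{g \<in> borel_measurable borel. \<forall>x::'a. \<bar>g x :: real\<bar> \<le> 1}"
  have bound: "\<bar>LINT x|R. h x\<bar> \<le> 1" if "h \<in> ?G" "prob_space R" "sets R = sets borel" for h and R :: "'a measure"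
  proof -
    interpret prob_space R by fact
    have "integrable R h"
      using that by (intro integrable_const_bound[where B=1]) (auto cong: measurable_cong_sets)
    then have "(LINT x|R. h x) \<le> 1" "- 1 \<le> (LINT x|R. h x)"
      using that by (auto intro!: integral_le_const integral_ge_const simp: abs_le_iff minus_le_iff)
    then show ?thesis by (simp add: abs_le_iff)
  qed
  have "bdd_above ((\<lambda>g. \<bar>(LINT x|M. g x) - (LINT x|N. g x)\<bar>) ` ?G)"
  proof (rule bdd_aboveI2[where M=2])
    fix h assume "h \<in> ?G"
    then have "\<bar>LINT x|M. h x\<bar> \<le> 1" "\<bar>LINT x|N. h x\<bar> \<le> 1" using bound M N by auto
    then show "\<bar>(LINT x|M. h x) - (LINT x|N. h x)\<bar> \<le> 2" by linarith
  qed
  then show ?thesis unfolding tv_dist_def by (intro cSUP_upper) (use g in auto)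
qed

lemma tv_dist_nonneg:
  "prob_space M \<Longrightarrow> sets M = sets borel \<Longrightarrow> prob_space N \<Longrightarrow> sets N = sets borel \<Longrightarrow> 0 \<le> tv_dist M N"
  using integral_diff_le_tv_dist[of M N "\<lambda>_. 0"] by simp

section \<open>The Markov property on path space\<close>

context markov_family
begin

definition shifted_path :: "real \<Rightarrow> 'w \<Rightarrow> real \<Rightarrow> 'a" where
  "shifted_path v w = (\<lambda>s\<in>{0..}. X (v + s) w)"

lemma path_measurable: "0 \<le> v \<Longrightarrow> shifted_path v \<in> S \<rightarrow>\<^sub>M path_algebra"
  unfolding shifted_path_def by (intro measurable_restrict X_measurable) auto

text \<open>
  The Markov property for whole paths. Both sides are finite measures on the product algebra, and
  they agree on cylinders.
\<close>
lemma path_law_markov: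
  assumes v: "0 \<le> v"
  shows "distr (P x) path_algebra (shifted_path v) =
    distr (P x) borel (X v) \<bind> (\<lambda>y. distr (P y) path_algebra (shifted_path 0))"
proof (rule measure_eqI_PiM_infinite)
  interpret prob_space "P x" by simp
  have ne: "space S \<noteq> {}" using not_empty by simp
  have [measurable]: "X v \<in> borel_measurable S" using v by (rule X_measurable)
  have pm [measurable]: "shifted_path v \<in> S \<rightarrow>\<^sub>M path_algebra" "shifted_path 0 \<in> S \<rightarrow>\<^sub>M path_algebra"
    using v by (auto intro: path_measurable)
  have K [measurable]: "(\<lambda>y. distr (P y) path_algebra (shifted_path 0)) \<in> borel \<rightarrow>\<^sub>M subprob_algebra path_algebra"
    by (rule measurable_compose[OF kernel_subprob measurable_distr]) measurable
  show "sets (distr (P x) borel (X v) \<bind> (\<lambda>y. distr (P y) path_algebra (shifted_path 0))) = sets path_algebra"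
    by (rule sets_bind) (auto simp: ne)
  show "finite_measure (distr (P x) path_algebra (shifted_path v))"
    by (intro finite_measure_distr) simp
  fix A :: "real \<Rightarrow> 'a set" and J :: "real set"
  assume J: "finite J" "J \<subseteq> {0..}" and A: "\<And>j. j \<in> J \<Longrightarrow> A j \<in> sets borel"
  let ?C = "prod_emb {0..} (\<lambda>_. borel) J (Pi\<^sub>E J A)"
  have C[measurable]: "?C \<in> sets path_algebra"
    using J A by (intro sets_PiM_I) auto
  have pre: "shifted_path u -` ?C \<inter> space S = {w \<in> space S. \<forall>j\<in>J. X (u + j) w \<in> A j}" for u
    using J by (auto simp: shifted_path_def prod_emb_def PiE_iff restrict_def extensional_def subset_eq split: if_splits)
  have "emeasure (distr (P x) path_algebra (shifted_path v)) ?C = emeasure (P x) {w \<in> space S. \<forall>j\<in>J. X (v + j) w \<in> A j}"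
    by (subst emeasure_distr) (auto simp: pre)
  also have "\<dots> = (\<integral>\<^sup>+w. emeasure (P (X v w)) {w' \<in> space S. \<forall>j\<in>J. X j w' \<in> A j} \<partial>P x)"
    by (rule cylinder_markov[OF J A v])
  also have "\<dots> = (\<integral>\<^sup>+w. emeasure (distr (P (X v w)) path_algebra (shifted_path 0)) ?C \<partial>P x)"
    by (subst emeasure_distr) (auto simp: pre)
  also have "\<dots> = emeasure (distr (P x) borel (X v) \<bind> (\<lambda>y. distr (P y) path_algebra (shifted_path 0))) ?C"
    by (subst emeasure_bind[where N=path_algebra]) (auto simp: nn_integral_distr ne)
  finally show "emeasure (distr (P x) path_algebra (shifted_path v)) ?C =
      emeasure (distr (P x) borel (X v) \<bind> (\<lambda>y. distr (P y) path_algebra (shifted_path 0))) ?C" .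
qed simp

lemma initial_law:
  assumes "prob_space \<nu>" "sets \<nu> = sets borel"
  shows sets_initial_law: "sets (\<nu> \<bind> P) = sets S"
    and space_initial_law: "space (\<nu> \<bind> P) = space S"
    and prob_space_initial_law: "prob_space (\<nu> \<bind> P)"
    and measure_initial_law: "E \<in> sets S \<Longrightarrow> measure (\<nu> \<bind> P) E = (LINT x|\<nu>. measure (P x) E)"
proof -
  interpret prob_space \<nu> by fact
  have K: "P \<in> \<nu> \<rightarrow>\<^sub>M subprob_algebra S" using kernel_subprob assms(2) by (simp cong: measurable_cong_sets)
  show "sets (\<nu> \<bind> P) = sets S" by (rule sets_bind) (auto simp: not_empty)
  then show "space (\<nu> \<bind> P) = space S" by (rule sets_eq_imp_space_eq)
  show "prob_space (\<nu> \<bind> P)" by (rule prob_space_bind[OF _ K]) simp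
  show "measure (\<nu> \<bind> P) E = (LINT x|\<nu>. measure (P x) E)" if "E \<in> sets S"
    by (rule measure_bind[OF K that])
qed

text \<open>
  Let \<open>h y\<close> be the probability of \<open>B\<close> for the path started in \<open>y\<close>. By the Markov property the left-hand
  probability is the mean of \<open>h\<close> under the law of \<open>X v\<close>, while the mean of \<open>h\<close> under \<open>\<mu>\<close> is the
  probability of \<open>B\<close> for the path started from \<open>\<mu>\<close>. As \<open>0 \<le> h \<le> 1\<close>, the total variation distance
  controls the difference of the two means.
\<close>
lemma path_event_tv_bound:
  assumes \<nu>: "prob_space \<nu>" "sets \<nu> = sets borel" and \<mu>: "prob_space \<mu>" "sets \<mu> = sets borel"
    and v: "0 \<le> v" and B [measurable]: "B \<in> sets path_algebra"
    and D: "\<And>x. tv_dist (distr (P x) borel (X v)) \<mu> \<le> D x" "integrable \<nu> D"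
  shows "measure (\<nu> \<bind> P) {w \<in> space S. shifted_path v w \<in> B} \<le>
    measure (\<mu> \<bind> P) {w \<in> space S. shifted_path 0 w \<in> B} + (LINT x|\<nu>. D x)"
proof -
  interpret nu: prob_space \<nu> by fact
  have [measurable]: "X v \<in> borel_measurable S" using v by (rule X_measurable)
  have pm [measurable]: "shifted_path v \<in> S \<rightarrow>\<^sub>M path_algebra" "shifted_path 0 \<in> S \<rightarrow>\<^sub>M path_algebra"
    using v by (auto intro: path_measurable)
  have E [measurable]: "{w \<in> space S. shifted_path v w \<in> B} \<in> sets S" "{w \<in> space S. shifted_path 0 w \<in> B} \<in> sets S"
    by measurable
  define h where "h y = measure (P y) {w \<in> space S. shifted_path 0 w \<in> B}" for y
  have h [measurable]: "h \<in> borel_measurable borel"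
    unfolding h_def by (rule measurable_compose[OF kernel_subprob measurable_measure_subprob_algebra[OF E(2)]])
  have h01: "0 \<le> h y" "h y \<le> 1" for y
    by (auto simp: h_def prob_space.prob_le_1)
  have K [measurable]: "(\<lambda>y. distr (P y) path_algebra (shifted_path 0)) \<in> borel \<rightarrow>\<^sub>M subprob_algebra path_algebra"
    by (rule measurable_compose[OF kernel_subprob measurable_distr]) measurable
  have pre: "shifted_path u -` B \<inter> space S = {w \<in> space S. shifted_path u w \<in> B}" for u by auto
  have mean: "(LINT x|\<mu>. h x) = measure (\<mu> \<bind> P) {w \<in> space S. shifted_path 0 w \<in> B}"
    by (simp add: h_def measure_initial_law[OF \<mu>])
  have pt: "measure (P x) {w \<in> space S. shifted_path v w \<in> B} \<le> (LINT x|\<mu>. h x) + D x" for x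
  proof -
    interpret prob_space "P x" by simp
    interpret d: prob_space "distr (P x) borel (X v)" by (rule prob_space_distr) simp
    have "measure (P x) {w \<in> space S. shifted_path v w \<in> B} = measure (distr (P x) path_algebra (shifted_path v)) B"
      by (subst measure_distr) (auto simp: pre)
    also have "\<dots> = (LINT y|distr (P x) borel (X v). measure (distr (P y) path_algebra (shifted_path 0)) B)"
      unfolding path_law_markov[OF v] by (rule d.measure_bind[where N=path_algebra]) auto
    also have "\<dots> = (LINT y|distr (P x) borel (X v). h y)"
      by (intro Bochner_Integration.integral_cong) (auto simp: h_def measure_distr pre)
    also have "\<dots> \<le> (LINT x|\<mu>. h x) + tv_dist (distr (P x) borel (X v)) \<mu>"
      using integral_diff_le_tv_dist[OF d.prob_space_axioms _ \<mu> h] h01 by (force simp: abs_le_iff)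
    finally show ?thesis using D(1)[of x] by linarith
  qed
  have "measure (\<nu> \<bind> P) {w \<in> space S. shifted_path v w \<in> B} = (LINT x|\<nu>. measure (P x) {w \<in> space S. shifted_path v w \<in> B})"
    by (rule measure_initial_law[OF \<nu> E(1)])
  also have "\<dots> \<le> (LINT x|\<nu>. (LINT x|\<mu>. h x) + D x)"
  proof (rule integral_mono)
    have "(\<lambda>x. measure (P x) {w \<in> space S. shifted_path v w \<in> B}) \<in> borel_measurable borel"
      by (rule measurable_compose[OF kernel_subprob measurable_measure_subprob_algebra[OF E(1)]])
    then show "integrable \<nu> (\<lambda>x. measure (P x) {w \<in> space S. shifted_path v w \<in> B})"
      using \<nu>(2) by (intro nu.integrable_const_bound[where B=1]) (auto simp: prob_space.prob_le_1 cong: measurable_cong_sets)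
  qed (use D pt in auto)
  also have "\<dots> = (LINT x|\<mu>. h x) + (LINT x|\<nu>. D x)"
    using D by (simp add: nu.prob_space)
  finally show ?thesis by (simp only: mean)
qed

text \<open>
  One functional \<open>\<Phi>\<close> serves all shifts \<open>v\<close>: burning in amounts to looking at the shifted path.
\<close>
lemma burn_in_avg_path:
  assumes f: "f \<in> borel_measurable borel"
  obtains \<Phi> where "\<Phi> \<in> borel_measurable path_algebra"
    "\<And>v w. 0 \<le> v \<Longrightarrow> w \<in> space S \<Longrightarrow> burn_in_avg X v t f w = \<Phi> (shifted_path v w)"
proof -
  obtain \<Phi> where \<Phi> [measurable]: "\<Phi> \<in> borel_measurable (path_algebra :: (real \<Rightarrow> 'a) measure)" and
    eq: "\<And>\<omega>. continuous_on {0..} \<omega> \<Longrightarrow> \<Phi> (restrict \<omega> {0..}) = (LINT s:{0..t}|lborel. f (\<omega> s))"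
    using time_integral_path_measurable[OF f] by blast
  show ?thesis
  proof
    show "(\<lambda>\<omega>. 1 / t * \<Phi> \<omega>) \<in> borel_measurable path_algebra" by measurable
    fix v w assume v: "(0::real) \<le> v" and w: "w \<in> space S"
    have "continuous_on {0..} (\<lambda>s. X (v + s) w)"
      by (rule continuous_on_compose2[OF X_continuous[OF w]]) (use v in \<open>auto intro!: continuous_intros\<close>)
    from eq[OF this] show "burn_in_avg X v t f w = 1 / t * \<Phi> (shifted_path v w)"
      by (simp add: burn_in_avg_def shifted_path_def set_integral_shift)
  qed
qed

lemma burn_in_avg_measurable:
  assumes f: "f \<in> borel_measurable borel" and v: "0 \<le> v"
  shows "burn_in_avg X v t f \<in> borel_measurable S"
proof -
  obtain \<Phi> where [measurable]: "\<Phi> \<in> borel_measurable path_algebra" and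
    eq: "\<And>v w. 0 \<le> v \<Longrightarrow> w \<in> space S \<Longrightarrow> burn_in_avg X v t f w = \<Phi> (shifted_path v w)"
    using burn_in_avg_path[OF f] by blast
  note path_measurable[OF v, measurable]
  have "(\<lambda>w. \<Phi> (shifted_path v w)) \<in> borel_measurable S" by measurable
  then show ?thesis by (rule measurable_cong[THEN iffD1, rotated]) (simp add: eq v)
qed

lemma burn_in_deviation_bound:
  assumes f: "f \<in> borel_measurable borel"
    and \<nu>: "prob_space \<nu>" "sets \<nu> = sets borel" and \<mu>: "prob_space \<mu>" "sets \<mu> = sets borel"
    and v: "0 \<le> v"
    and D: "\<And>x. tv_dist (distr (P x) borel (X v)) \<mu> \<le> D x" "integrable \<nu> D"
  shows "measure (\<nu> \<bind> P) {w \<in> space S. \<bar>burn_in_avg X v t f w - m\<bar> > \<epsilon>} \<le>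
    measure (\<mu> \<bind> P) {w \<in> space S. \<bar>burn_in_avg X 0 t f w - m\<bar> > \<epsilon>} + (LINT x|\<nu>. D x)"
proof -
  obtain \<Phi> where [measurable]: "\<Phi> \<in> borel_measurable path_algebra" and
    eq: "\<And>v w. 0 \<le> v \<Longrightarrow> w \<in> space S \<Longrightarrow> burn_in_avg X v t f w = \<Phi> (shifted_path v w)"
    using burn_in_avg_path[OF f] by blast
  let ?B = "{\<omega> \<in> space path_algebra. \<bar>\<Phi> \<omega> - m\<bar> > \<epsilon>}"
  have "?B \<in> sets path_algebra" by measurable
  from path_event_tv_bound[OF \<nu> \<mu> v this D]
  have "measure (\<nu> \<bind> P) {w \<in> space S. shifted_path v w \<in> ?B} \<le>
    measure (\<mu> \<bind> P) {w \<in> space S. shifted_path 0 w \<in> ?B} + (LINT x|\<nu>. D x)" .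
  moreover have "{w \<in> space S. shifted_path u w \<in> ?B} = {w \<in> space S. \<bar>burn_in_avg X u t f w - m\<bar> > \<epsilon>}"
    if "0 \<le> u" for u
    using measurable_space[OF path_measurable[OF that]] that by (auto simp: eq)
  ultimately show ?thesis using v by simp
qed

end

section \<open>The stationary average\<close>

text \<open>
  A continuous path stays in a ball on \<open>[0, t]\<close>, and functions of polynomial growth are bounded on balls.
\<close>
lemma class_G_path_integrable:
  fixes f :: "real ^ 'd \<Rightarrow> real" and t :: real
  assumes f: "f \<in> class_G \<eta> \<LL>" and \<eta>: "0 \<le> \<eta>" and \<LL>: "0 \<le> \<LL>" and \<omega>: "continuous_on {0..t} \<omega>" and t: "0 \<le> t"
  shows "set_integrable lborel {0..t} (\<lambda>s. f (\<omega> s))"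
proof -
  have fm [measurable]: "f \<in> borel_measurable borel" and fb: "\<And>x. \<bar>f x\<bar> \<le> \<LL> * (1 + pow0 (norm x) \<eta>)"
    using f by (auto simp: class_G_def)
  obtain R where R: "\<And>s. s \<in> {0..t} \<Longrightarrow> norm (\<omega> s) \<le> R"
    using compact_imp_bounded[OF compact_continuous_image[OF \<omega> compact_Icc]] unfolding bounded_iff by blast
  \<comment> \<open>Clamping the time to \<open>[0, t]\<close> extends the path to a continuous, hence Borel, function on the line.\<close>
  define \<omega>' where "\<omega>' s = \<omega> (max 0 (min t s))" for s
  have "continuous_on UNIV \<omega>'"
    unfolding \<omega>'_def by (rule continuous_on_compose2[OF \<omega>]) (use t in \<open>auto intro!: continuous_intros\<close>)
  then have [measurable]: "\<omega>' \<in> borel_measurable borel" by (rule borel_measurable_continuous_onI)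
  have eq: "\<omega>' s = \<omega> s" if "s \<in> {0..t}" for s using that by (simp add: \<omega>'_def)
  have bd: "\<bar>f (\<omega>' s)\<bar> \<le> \<LL> * (1 + pow0 R \<eta>)" if s: "s \<in> {0..t}" for s
  proof -
    have "pow0 (norm (\<omega> s)) \<eta> \<le> pow0 R \<eta>"
      using R[OF s] \<eta> by (auto simp: pow0_def intro: powr_mono2)
    then have "\<LL> * (1 + pow0 (norm (\<omega> s)) \<eta>) \<le> \<LL> * (1 + pow0 R \<eta>)"
      using \<LL> by (intro mult_left_mono) auto
    then show ?thesis using fb[of "\<omega> s"] eq[OF s] by simp
  qed
  have "set_integrable lborel {0..t} (\<lambda>s. f (\<omega>' s))"
    unfolding set_integrable_def
    by (rule integrableI_bounded_set_indicator[where B="\<LL> * (1 + pow0 R \<eta>)"]) (use bd t in auto)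
  then show ?thesis
    by (rule set_integrable_cong[OF refl refl, THEN iffD1, rotated]) (simp add: eq)
qed

lemma burn_in_avg_eq_scaled_avg:
  fixes f :: "real ^ 'd \<Rightarrow> real"
  assumes f: "f \<in> class_G \<eta> \<LL>" "0 \<le> \<eta>" "0 \<le> \<LL>" and cont: "continuous_on {0..} (\<lambda>s. X s w)" and t: "0 < t"
  shows "scaled_avg X t (\<lambda>x. f x - m) w = sqrt t * (burn_in_avg X 0 t f w - m)"
proof -
  have c: "continuous_on {0..t} (\<lambda>s. X s w)" by (rule continuous_on_subset[OF cont]) auto
  have "(LINT s:{0..t}|lborel. f (X s w) - m) = (LINT s:{0..t}|lborel. f (X s w)) - (LINT s:{0..t}|lborel. m)"
    by (rule set_integral_diff(2)[OF class_G_path_integrable[OF f c]])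
       (use t in \<open>auto intro!: borel_integrable_atLeastAtMost'\<close>)
  also have "(LINT s:{0..t}|lborel. m) = t * m"
    using t by (simp add: set_lebesgue_integral_def)
  finally have I: "(LINT s:{0..t}|lborel. f (X s w) - m) = (LINT s:{0..t}|lborel. f (X s w)) - t * m" .
  have p: "t powr (- 1 / 2) = 1 / sqrt t"
    using powr_minus_divide[of t "1/2"] powr_half_sqrt[of t] t by simp
  have alg: "1 / r * (J - r * r * m) = r * (1 / (r * r) * J - m)" if "0 < r" for r J :: real
    using that by (simp add: field_simps)
  have "1 / sqrt t * (J - t * m) = sqrt t * (1 / t * J - m)" for J
    using alg[of "sqrt t" J] t by simp
  then show ?thesis unfolding scaled_avg_def burn_in_avg_def I p add_0_left .
qed

text \<open>
  Chebyshev's inequality for the \<open>p\<close>-th moment: the level exceeds the norm by the factor \<open>e\<close>, whose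
  \<open>p\<close>-th power is \<open>exp p\<close>. A separate level \<open>r\<close>, assumed positive, covers the degenerate bound \<open>a = 0\<close>.
\<close>
lemma (in prob_space) tail_bound_of_Lp_norm:
  fixes Y :: "'a \<Rightarrow> real"
  assumes int: "integrable M (\<lambda>w. \<bar>Y w\<bar> powr p)" and norm: "(LINT w|M. \<bar>Y w\<bar> powr p) powr (1 / p) \<le> a"
    and p: "0 < p" and r: "0 < r" "exp 1 * a \<le> r"
  shows "measure M {w \<in> space M. \<bar>Y w\<bar> > r} \<le> exp (- p)"
proof -
  let ?E = "LINT w|M. \<bar>Y w\<bar> powr p"
  have E0: "0 \<le> ?E" by simp
  have a0: "0 \<le> a" using norm powr_ge_zero order_trans by blast
  have "?E = (?E powr (1 / p)) powr p" using p E0 by (simp add: powr_powr)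
  also have "\<dots> \<le> a powr p" using norm p by (intro powr_mono2) auto
  also have "\<dots> \<le> (r / exp 1) powr p" using r a0 p by (intro powr_mono2) (auto simp: field_simps)
  also have "\<dots> = (r * exp (- 1)) powr p" by (simp add: exp_minus divide_inverse)
  also have "\<dots> = r powr p * exp (- p)" using r by (simp add: powr_mult exp_powr_real)
  finally have E: "?E \<le> r powr p * exp (- p)" .
  have "measure M {w \<in> space M. \<bar>Y w\<bar> > r} \<le> measure M {w \<in> space M. \<bar>Y w\<bar> powr p \<ge> r powr p}"
  proof (rule finite_measure_mono)
    show "{w \<in> space M. \<bar>Y w\<bar> > r} \<subseteq> {w \<in> space M. \<bar>Y w\<bar> powr p \<ge> r powr p}"
      using r p by (auto intro!: powr_mono2)
    have [measurable]: "(\<lambda>w. \<bar>Y w\<bar> powr p) \<in> borel_measurable M" using int by (rule borel_measurable_integrable)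
    show "{w \<in> space M. \<bar>Y w\<bar> powr p \<ge> r powr p} \<in> events" by measurable
  qed
  also have "\<dots> \<le> ?E / r powr p"
    by (rule integral_Markov_inequality_measure[where A="{}"]) (use int r in auto)
  also have "\<dots> \<le> exp (- p)" using E r by (simp add: field_simps)
  finally show ?thesis .
qed

lemma c_const_pos: "0 < \<iota>'' \<Longrightarrow> q < 1 \<Longrightarrow> 0 < c_const q \<iota>''"
  unfolding c_const_def by (intro mult_pos_pos) auto

text \<open>
  The sample length for bounded functions, with \<open>u = ln (4 / \<delta>)\<close> in mind. It gives
  \<open>A + 1 \<le> sqrt t * min 1 (\<epsilon> / (2 * \<LL>))\<close>. The bound by 1 in the minimum yields \<open>A + 1 \<le> sqrt t\<close>, so \<open>u\<close>
  lies in the range of the deviation inequality even after \<open>t\<close> is rounded down; the other bound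
  makes the deviation level at most \<open>\<epsilon> * sqrt t\<close>.
\<close>
lemma Psi_zero_bounds:
  fixes u t q \<iota>'' \<LL> \<epsilon> :: real
  defines "A \<equiv> u powr (1 / (1 - qpos q)) / c_const q \<iota>''"
  assumes u: "0 < u" and t: "0 < t" and c: "0 < \<iota>''" "q < 1" and pos: "0 < \<LL>" "0 < \<epsilon>"
    and Psi: "((A + 1) / min 1 (\<epsilon> / (2 * \<LL>)))\<^sup>2 \<le> t"
  shows "u < (c_const q \<iota>'' * of_int \<lfloor>t\<rfloor> / sqrt t) powr (1 - qpos q)"
    and "2 * \<LL> * (A + t powr (- 1/2)) \<le> \<epsilon> * sqrt t"
proof -
  define m where "m = min 1 (\<epsilon> / (2 * \<LL>))"
  have c0: "0 < c_const q \<iota>''" using c by (rule c_const_pos)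
  have \<kappa>: "0 < 1 - qpos q" using c by simp
  have A0: "0 < A" using u c0 by (simp add: A_def)
  have m: "0 < m" "m \<le> 1" "m \<le> \<epsilon> / (2 * \<LL>)" using pos by (auto simp: m_def)
  have "\<bar>(A + 1) / m\<bar> \<le> sqrt t" using real_sqrt_le_mono[OF Psi] unfolding m_def real_sqrt_abs .
  then have st: "A + 1 \<le> sqrt t * m" using m A0 by (simp add: field_simps)
  have "sqrt t * m \<le> sqrt t" using m t by (simp add: mult_left_le)
  then have st1: "A + 1 \<le> sqrt t" "1 \<le> sqrt t" using st A0 by linarith+
  have tt: "t = sqrt t * sqrt t" using t by simp
  have "A * sqrt t \<le> (sqrt t - 1) * sqrt t" using st1 t by (intro mult_right_mono) auto
  also have "\<dots> \<le> t - 1" using st1 tt by (simp add: algebra_simps)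
  also have "\<dots> < of_int \<lfloor>t\<rfloor>" by linarith
  finally have Afl: "A < of_int \<lfloor>t\<rfloor> / sqrt t" using t by (simp add: field_simps)
  have "u = (c_const q \<iota>'' * A) powr (1 - qpos q)"
    using c0 u \<kappa> by (simp add: A_def powr_powr)
  also have "\<dots> < (c_const q \<iota>'' * (of_int \<lfloor>t\<rfloor> / sqrt t)) powr (1 - qpos q)"
    by (rule powr_less_mono2[OF \<kappa> _ mult_strict_left_mono[OF Afl c0]]) (use c0 A0 in simp)
  finally show "u < (c_const q \<iota>'' * of_int \<lfloor>t\<rfloor> / sqrt t) powr (1 - qpos q)" by simp
  have "t powr (- 1/2) = 1 / sqrt t"
    using powr_minus_divide[of t "1/2"] powr_half_sqrt[of t] t by simp
  then have "t powr (- 1/2) \<le> 1" using st1 by simp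
  then have "2 * \<LL> * (A + t powr (- 1/2)) \<le> 2 * \<LL> * (sqrt t * m)"
    using st pos by (intro mult_left_mono) auto
  also have "\<dots> \<le> 2 * \<LL> * (sqrt t * (\<epsilon> / (2 * \<LL>)))"
    using m pos t by (intro mult_left_mono) auto
  also have "\<dots> = \<epsilon> * sqrt t" using pos by simp
  finally show "2 * \<LL> * (A + t powr (- 1/2)) \<le> \<epsilon> * sqrt t" .
qed

text \<open>
  For \<open>\<eta> = 0\<close> the deviation inequality is applied with \<open>u = ln (4 / \<delta>)\<close>, where its bound \<open>2 * exp (- u)\<close>
  equals \<open>\<delta> / 2\<close>. For \<open>\<eta> > 0\<close> the moment inequality is applied with the order \<open>p = ln (2 / \<delta>)\<close>,
  where Chebyshev's bound \<open>exp (- p)\<close> equals \<open>\<delta> / 2\<close>. The assumptions on the size of \<open>\<delta>\<close> say that \<open>u\<close> and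
  \<open>p\<close> are large enough for these inequalities.
\<close>
lemma stationary_deviation_bound:
  fixes X :: "real \<Rightarrow> 'w \<Rightarrow> real ^ 'd"
  assumes X: "markov_family S X P"
    and \<mu>: "prob_space \<mu>" "sets \<mu> = sets borel"
    and \<cc>: "deviation_constant X P \<mu> q \<iota>'' \<LL> \<cc>"
    and \<WW>: "moment_constant X P \<mu> q q' \<eta> \<WW>"
    and q: "q < 1" and \<iota>'': "0 < \<iota>''"
    and params: "\<eta> \<ge> 0" "\<LL> > 0" "\<epsilon> > 0" "0 < \<delta>" "\<delta> < 1"
    and \<delta>_pos: "\<eta> > 0 \<Longrightarrow> \<delta> < 2 * exp (- 2)"
    and \<delta>_zero: "\<eta> = 0 \<Longrightarrow>
      \<delta> < 4 * exp (- (\<cc> * (1 + qpos q) * (1 - qpos q) powr (- (1 - qpos q) / 2)))"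
    and t: "t > 0" "t \<ge> Psi q q' \<eta> \<LL> \<iota>'' \<WW> \<epsilon> (\<delta> / 2)"
    and f: "f \<in> class_G \<eta> \<LL>"
  shows "measure (\<mu> \<bind> P) {w \<in> space S. \<bar>burn_in_avg X 0 t f w - (LINT x|\<mu>. f x)\<bar> > \<epsilon>} \<le> \<delta> / 2"
proof -
  interpret markov_family S X P by fact
  interpret Q: prob_space "\<mu> \<bind> P" by (rule prob_space_initial_law[OF \<mu>])
  let ?m = "LINT x|\<mu>. f x"
  let ?f = "\<lambda>x. f x - ?m"
  have fm: "f \<in> borel_measurable borel" using f by (simp add: class_G_def)
  have F: "?f \<in> class_F \<mu> \<eta> \<LL>" using f by (auto simp: class_F_def)
  have sc: "scaled_avg X t ?f w = sqrt t * (burn_in_avg X 0 t f w - ?m)" if "w \<in> space S" for w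
    by (rule burn_in_avg_eq_scaled_avg[OF f]) (use params t X_continuous[OF that] in auto)
  have scm: "scaled_avg X t ?f \<in> borel_measurable S"
  proof (rule measurable_cong[THEN iffD2, OF sc])
    show "(\<lambda>w. sqrt t * (burn_in_avg X 0 t f w - ?m)) \<in> borel_measurable S"
      using burn_in_avg_measurable[OF fm order_refl, of t] by measurable
  qed
  \<comment> \<open>Levels up to \<open>\<epsilon> * sqrt t\<close> are relevant, because both tail inequalities concern the integral scaled by
    \<open>1 / sqrt t\<close> instead of \<open>1 / t\<close>.\<close>
  have rescale: "measure (\<mu> \<bind> P) {w \<in> space S. \<bar>burn_in_avg X 0 t f w - ?m\<bar> > \<epsilon>} \<le>
      measure (\<mu> \<bind> P) {w \<in> space (\<mu> \<bind> P). \<bar>scaled_avg X t ?f w\<bar> > r}" if r: "r \<le> \<epsilon> * sqrt t" for r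
  proof (rule Q.finite_measure_mono)
    show "{w \<in> space S. \<bar>burn_in_avg X 0 t f w - ?m\<bar> > \<epsilon>} \<subseteq> {w \<in> space (\<mu> \<bind> P). \<bar>scaled_avg X t ?f w\<bar> > r}"
    proof safe
      fix w assume w: "w \<in> space S" and d: "\<bar>burn_in_avg X 0 t f w - ?m\<bar> > \<epsilon>"
      show "w \<in> space (\<mu> \<bind> P)" using w by (simp add: space_initial_law[OF \<mu>])
      have "\<epsilon> * sqrt t < \<bar>burn_in_avg X 0 t f w - ?m\<bar> * sqrt t"
        using d t by (intro mult_strict_right_mono) auto
      moreover have "\<bar>scaled_avg X t ?f w\<bar> = \<bar>burn_in_avg X 0 t f w - ?m\<bar> * sqrt t"
        using t by (simp add: sc[OF w] abs_mult)
      ultimately show "r < \<bar>scaled_avg X t ?f w\<bar>" using r by linarith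
    qed
    have "scaled_avg X t ?f \<in> borel_measurable (\<mu> \<bind> P)"
      using scm by (simp add: sets_initial_law[OF \<mu>] cong: measurable_cong_sets)
    then show "{w \<in> space (\<mu> \<bind> P). \<bar>scaled_avg X t ?f w\<bar> > r} \<in> sets (\<mu> \<bind> P)" by measurable
  qed
  show ?thesis
  proof (cases "\<eta> = 0")
    case True
    define u where "u = ln (4 / \<delta>)"
    define A where "A = u powr (1 / (1 - qpos q)) / c_const q \<iota>''"
    have u: "0 < u" using params by (simp add: u_def)
    have "\<cc> * (1 + qpos q) * (1 - qpos q) powr (- (1 - qpos q) / 2) \<le> u"
    proof -
      let ?k = "\<cc> * (1 + qpos q) * (1 - qpos q) powr (- (1 - qpos q) / 2)"
      have "exp ?k * \<delta> \<le> exp ?k * (4 * exp (- ?k))"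
        using \<delta>_zero[OF True] by (intro mult_left_mono) auto
      also have "\<dots> = 4" by (simp add: exp_minus)
      finally have "exp ?k \<le> 4 / \<delta>" using params by (simp add: field_simps)
      then show ?thesis unfolding u_def using params by (subst ln_ge_iff) auto
    qed
    moreover have "((A + 1) / min 1 (\<epsilon> / (2 * \<LL>)))\<^sup>2 \<le> t"
      using t(2) True by (simp add: Psi_def A_def u_def)
    note Psi_zero_bounds[OF u t(1) \<iota>'' q params(2,3) this[unfolded A_def]]
    ultimately have tail: "measure (\<mu> \<bind> P) {w \<in> space (\<mu> \<bind> P). \<bar>scaled_avg X t ?f w\<bar> >
          2 * \<LL> * (A + t powr (- 1/2))} \<le> 2 * exp (- u)"
      and r: "2 * \<LL> * (A + t powr (- 1/2)) \<le> \<epsilon> * sqrt t"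
      using \<cc> F u t(1) True unfolding deviation_constant_def A_def by blast+
    have "2 * exp (- u) = \<delta> / 2" using params by (simp add: u_def exp_minus)
    with rescale[OF r] tail show ?thesis by linarith
  next
    case False
    then have \<eta>: "0 < \<eta>" using params by simp
    define p where "p = ln (2 / \<delta>)"
    have p: "2 \<le> p"
    proof -
      have "exp 2 * \<delta> \<le> exp 2 * (2 * exp (- 2))"
        using \<delta>_pos[OF \<eta>] by (intro mult_left_mono) auto
      also have "\<dots> = 2" by (simp add: exp_minus)
      finally have "exp 2 \<le> 2 / \<delta>" using params by (simp add: field_simps)
      then show ?thesis unfolding p_def using params by (subst ln_ge_iff) auto
    qed
    define a where "a = \<LL> * \<WW> * p powr moment_exponent q q' \<eta>"
    have int: "integrable (\<mu> \<bind> P) (\<lambda>w. \<bar>scaled_avg X t ?f w\<bar> powr p)"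
      and norm: "(LINT w|(\<mu> \<bind> P). \<bar>scaled_avg X t ?f w\<bar> powr p) powr (1 / p) \<le> a"
      using \<WW> F params t p unfolding moment_constant_def a_def by blast+
    have "(exp 1 * a / \<epsilon>)\<^sup>2 \<le> t"
      using t(2) False by (simp add: Psi_def a_def p_def mult.assoc)
    then have "exp 1 * a / \<epsilon> \<le> sqrt t" by (rule real_le_rsqrt)
    then have "exp 1 * a \<le> \<epsilon> * sqrt t" using params by (simp add: field_simps)
    then have "measure (\<mu> \<bind> P) {w \<in> space (\<mu> \<bind> P). \<bar>scaled_avg X t ?f w\<bar> > \<epsilon> * sqrt t} \<le> exp (- p)"
      by (intro Q.tail_bound_of_Lp_norm[OF int norm]) (use p params t in auto)
    moreover have "exp (- p) = \<delta> / 2" using params by (simp add: p_def exp_minus)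
    ultimately show ?thesis using rescale[OF order_refl] by linarith
  qed
qed

section \<open>The burn-in period and the sample length\<close>

text \<open>
  If \<open>C\<close> is positive, the exponent exceeds \<open>ln (2 * C / \<delta>)\<close>. Otherwise the left-hand side is not positive,
  whatever value the logarithm then has.
\<close>
lemma burn_in_factor_le:
  fixes C \<delta> \<kappa> v i :: real
  assumes "0 < \<kappa>" "0 < \<delta>" "0 < i" and v: "max 0 (ln (2 * C / \<delta>)) powr (1 / \<kappa>) / i \<le> v"
  shows "C * exp (- ((i * v) powr \<kappa>)) \<le> \<delta> / 2"
proof (cases "0 < C")
  case True
  let ?l = "max 0 (ln (2 * C / \<delta>))"
  have "?l powr (1 / \<kappa>) \<le> i * v" using v assms by (simp add: field_simps)
  then have "(?l powr (1 / \<kappa>)) powr \<kappa> \<le> (i * v) powr \<kappa>" using assms by (intro powr_mono2) auto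
  then have "ln (2 * C / \<delta>) \<le> (i * v) powr \<kappa>" using assms by (simp add: powr_powr)
  then have "exp (- ((i * v) powr \<kappa>)) \<le> exp (- ln (2 * C / \<delta>))" by simp
  also have "\<dots> = \<delta> / (2 * C)" using True assms by (simp add: exp_minus)
  finally show ?thesis using True by (simp add: field_simps)
next
  case False
  then have "C * exp (- ((i * v) powr \<kappa>)) \<le> 0" by (simp add: mult_nonpos_nonneg)
  then show ?thesis using assms by linarith
qed

lemma markov_family_of_markovian_weak_solution:
  "markovian_weak_solution S b \<sigma> X P \<Longrightarrow> markov_family S X P"
  unfolding markovian_weak_solution_def markov_family_def by blast

text \<open>
  Passing from \<open>\<iota>'\<close> to \<open>\<iota>''\<close> under the constant \<open>Cq\<close> requires \<open>Cq\<close> to be nonnegative, which follows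
  because it multiplies a positive quantity in an upper bound for a distance.
\<close>
lemma tv_constant_exponential:
  assumes Cq: "tv_constant X P \<mu> q \<iota> \<iota>' Cq"
    and c'': "(1 + s) powr (2 * qpos q / (1 + qpos q)) * exp (- ((\<iota>' * s) powr ((1 - qpos q) / (1 + qpos q))))
              \<le> c'' * exp (- ((\<iota>'' * s) powr ((1 - qpos q) / (1 + qpos q))))"
    and s: "0 \<le> s"
    and nn: "0 \<le> tv_dist (distr (P x) borel (X s)) \<mu>"
  shows "tv_dist (distr (P x) borel (X s)) \<mu> \<le>
    Cq * c'' * exp (- ((\<iota>'' * s) powr ((1 - qpos q) / (1 + qpos q)))) * V_fun \<iota> q x"
proof -
  let ?g = "(1 + s) powr (2 * qpos q / (1 + qpos q)) * exp (- ((\<iota>' * s) powr ((1 - qpos q) / (1 + qpos q))))"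
  have V: "0 < V_fun \<iota> q x" by (simp add: V_fun_def)
  have g: "0 < ?g" using s by simp
  have tv: "tv_dist (distr (P x) borel (X s)) \<mu> \<le> Cq * V_fun \<iota> q x * ?g"
    using Cq s unfolding tv_constant_def by (simp add: mult.assoc)
  have "0 \<le> Cq * (V_fun \<iota> q x * ?g)" using nn tv by (simp add: mult.assoc)
  then have "0 \<le> Cq" using mult_neg_pos[OF _ mult_pos_pos[OF V g], of Cq] by linarith
  then have "Cq * V_fun \<iota> q x * ?g \<le>
      Cq * V_fun \<iota> q x * (c'' * exp (- ((\<iota>'' * s) powr ((1 - qpos q) / (1 + qpos q)))))"
    using V by (intro mult_left_mono[OF c'']) simp
  with tv show ?thesis by (simp add: mult_ac)
qed

theorem corollary3p8:
  fixes S :: "'w measure"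
    and X :: "real \<Rightarrow> 'w \<Rightarrow> real ^ 'd"
    and P :: "real ^ 'd \<Rightarrow> 'w measure"
    and b :: "real ^ 'd \<Rightarrow> real ^ 'd"
    and \<sigma> :: "real ^ 'd \<Rightarrow> real ^ 'd ^ 'd"
    and \<mu> \<nu> :: "(real ^ 'd) measure"
    and f :: "real ^ 'd \<Rightarrow> real"
    and q q' M\<^sub>0 \<rr> \<iota> \<iota>' \<iota>'' Cq c'' C \<cc> \<WW> \<eta> \<LL> \<epsilon> \<delta> v t :: real
  assumes X: "markovian_weak_solution S b \<sigma> X P"
    and b: "locally_lipschitz b"
      "q' \<ge> 0" "\<exists>K. \<forall>x. norm (b x) \<le> K * (1 + pow0 (norm x) q')"
    and \<sigma>: "uniformly_continuous_on UNIV \<sigma>" "bounded (range \<sigma>)" "locally_lipschitz \<sigma>"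
      "uniformly_elliptic (diffusion_matrix \<sigma>)"
    and drift: "- 1 \<le> q" "q < 1" "M\<^sub>0 \<ge> 0" "\<rr> > 0" "drift_condition b q M\<^sub>0 \<rr>"
    and \<mu>: "invariant_distribution X P \<mu>"
    and \<iota>: "\<iota> > 0" "\<rr> > \<iota> * lambda_plus (diffusion_matrix \<sigma>) * (1 - qpos q) / 2"
    and \<iota>': "\<iota>' = iota' q \<iota> \<rr> (lambda_plus (diffusion_matrix \<sigma>))"
    and \<iota>'': "0 < \<iota>''" "\<iota>'' < \<iota>'"
    and Cq: "tv_constant X P \<mu> q \<iota> \<iota>' Cq"
    and \<cc>: "deviation_constant X P \<mu> q \<iota>'' \<LL> \<cc>"
    and \<WW>: "moment_constant X P \<mu> q q' \<eta> \<WW>"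
    and params: "\<eta> \<ge> 0" "\<LL> > 0" "\<epsilon> > 0" "0 < \<delta>" "\<delta> < 1"
    and \<delta>_pos: "\<eta> > 0 \<Longrightarrow> \<delta> < 2 * exp (- 2)"
    and \<delta>_zero: "\<eta> = 0 \<Longrightarrow>
      \<delta> < 4 * exp (- (\<cc> * (1 + qpos q) * (1 - qpos q) powr (- (1 - qpos q) / 2)))"
    and \<nu>: "prob_space \<nu>" "sets \<nu> = sets borel" "integrable \<nu> (V_fun \<iota> q)"
    and c'': "\<forall>s\<ge>1. (1 + s) powr (2 * qpos q / (1 + qpos q))
                * exp (- ((\<iota>' * s) powr ((1 - qpos q) / (1 + qpos q))))
              \<le> c'' * exp (- ((\<iota>'' * s) powr ((1 - qpos q) / (1 + qpos q))))"
    and C: "C = Cq * c'' * (LINT x|\<nu>. \<bar>V_fun \<iota> q x\<bar>)"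
    and t: "t > 0" "t \<ge> Psi q q' \<eta> \<LL> \<iota>'' \<WW> \<epsilon> (\<delta> / 2)"
    and v: "v \<ge> max 1 (max 0 (ln (2 * C / \<delta>)) powr ((1 + qpos q) / (1 - qpos q)) / \<iota>'')"
    and f: "f \<in> class_G \<eta> \<LL>"
  shows "measure (\<nu> \<bind> P) {w \<in> space (\<nu> \<bind> P). \<bar>burn_in_avg X v t f w - (LINT x|\<mu>. f x)\<bar> \<le> \<epsilon>}
           \<ge> 1 - \<delta>"
proof -
  interpret markov_family S X P
    by (rule markov_family_of_markovian_weak_solution[OF X])
  have \<mu>': "prob_space \<mu>" "sets \<mu> = sets borel"
    using \<mu> by (auto simp: invariant_distribution_def)
  have fm: "f \<in> borel_measurable borel" using f by (simp add: class_G_def)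
  have v0: "0 \<le> v" using v by simp
  interpret PN: prob_space "\<nu> \<bind> P" by (rule prob_space_initial_law[OF \<nu>(1,2)])
  let ?m = "LINT x|\<mu>. f x"
  let ?bad = "\<lambda>s. {w \<in> space S. \<bar>burn_in_avg X s t f w - ?m\<bar> > \<epsilon>}"
  have bad: "?bad v \<in> sets S"
    using burn_in_avg_measurable[OF fm v0, of t] by measurable
  have stationary: "measure (\<mu> \<bind> P) (?bad 0) \<le> \<delta> / 2"
    by (rule stationary_deviation_bound[OF markov_family_axioms \<mu>' \<cc> \<WW> drift(2) \<iota>''(1) params \<delta>_pos \<delta>_zero t f])
  define D where "D x = Cq * c'' * exp (- ((\<iota>'' * v) powr ((1 - qpos q) / (1 + qpos q)))) * V_fun \<iota> q x" for x :: "real ^ 'd"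
  have tv: "tv_dist (distr (P x) borel (X v)) \<mu> \<le> D x" for x
    unfolding D_def
    by (rule tv_constant_exponential[OF Cq]) (use c'' v v0 tv_dist_nonneg[OF prob_space_law[OF v0] _ \<mu>'] in auto)
  have "(LINT x|\<nu>. D x) = C * exp (- ((\<iota>'' * v) powr ((1 - qpos q) / (1 + qpos q))))"
    by (simp add: D_def C V_fun_def mult_ac)
  also have "\<dots> \<le> \<delta> / 2"
    by (rule burn_in_factor_le) (use drift params \<iota>'' v in auto)
  finally have mixing: "(LINT x|\<nu>. D x) \<le> \<delta> / 2" .
  have "measure (\<nu> \<bind> P) (?bad v) \<le> \<delta>"
    using burn_in_deviation_bound[OF fm \<nu>(1,2) \<mu>' v0 tv, of \<epsilon> t ?m] \<nu>(3) stationary mixing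
    by (simp add: D_def)
  moreover have "{w \<in> space (\<nu> \<bind> P). \<bar>burn_in_avg X v t f w - ?m\<bar> \<le> \<epsilon>} = space (\<nu> \<bind> P) - ?bad v"
    by (auto simp: space_initial_law[OF \<nu>(1,2)])
  ultimately show ?thesis
    using PN.prob_compl[of "?bad v"] bad by (simp add: sets_initial_law[OF \<nu>(1,2)])
qed

end
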